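(* There exist uncountably many isomorphism classes of germs of $4$-webs of curves of rank one in a manifold of dimension three (in the holomorphic, respectively real analytic, category).
   Context: Everything is holomorphic, or everything is real analytic. A $4$-web of curves on a $3$-dimensional manifold is given locally by four one-dimensional foliations $\mathcal F_1,\dots,\mathcal F_4$ in general position: if $V_\lambda$ generates $T(\mathcal F_\lambda)$, any three of the four vector fields $V_\lambda$ are linearly independent at every point. A $2$-form $\eta$ is $\mathcal F$-basic if $\iota_w\eta=0$ and $L_w\eta=0$ for every vector field $w$ tangent to $\mathcal F$. An abelian relation of the web near a point is a family $(\eta_1,\eta_2,\eta_3,\eta_4)$ of $2$-forms with $\eta_1+\eta_2+\eta_3+\eta_4=0$ and each $\eta_\lambda$ being $\mathcal F_\lambda$-basic. The rank of the web is the (maximal) dimension of the space of germs of abelian relations at a point; it is always $0$ or $1$. Two germs of webs are isomorphic if there is a germ of biholomorphism (resp. real analytic diffeomorphism) mapping the foliations of one onto the foliations of the other. *)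

theory Defs
  imports "HOL-Analysis.Analysis" "HOL-Library.Extended_Nat"
begin

text \<open>
  The field \<open>'k\<close> stands for \<open>real\<close> (real analytic category) or \<open>complex\<close>
  (holomorphic category).  A germ at a point of a three-dimensional manifold is, in a
  chart, a germ at a point \<open>p\<close> of \<open>'k ^ 3\<close>; it is represented by a total function, of
  which only the values near \<open>p\<close> matter.
\<close>

text \<open>
  Convergent power series expansion at \<open>p\<close>: real analyticity for \<open>'k = real\<close>,
  holomorphy near \<open>p\<close> for \<open>'k = complex\<close>.
\<close>
definition analytic_fun_at :: "'k::real_normed_field ^ 'n \<Rightarrow> ('k ^ 'n \<Rightarrow> 'k) \<Rightarrow> bool" where
  "analytic_fun_at p f \<longleftrightarrow>
     (\<exists>c :: ('n \<Rightarrow> nat) \<Rightarrow> 'k. \<forall>\<^sub>F x in nhds p.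
        ((\<lambda>\<alpha>. c \<alpha> * (\<Prod>i\<in>UNIV. (x $ i - p $ i) ^ \<alpha> i)) has_sum f x) UNIV)"

definition analytic_map_at ::
  "'k::real_normed_field ^ 'n \<Rightarrow> ('k ^ 'n \<Rightarrow> 'k ^ 'm) \<Rightarrow> bool" where
  "analytic_map_at p f \<longleftrightarrow> (\<forall>i. analytic_fun_at p (\<lambda>x. f x $ i))"

text \<open>
  A one-dimensional foliation is encoded by its tangent line field \<open>T(F)\<close>; line fields
  are always integrable, so nothing else has to be recorded.
\<close>
type_synonym 'k foliation = "'k ^ 3 \<Rightarrow> ('k ^ 3) set"

type_synonym 'k web = "4 \<Rightarrow> 'k foliation"

definition generates_at ::
  "'k::real_normed_field ^ 3 \<Rightarrow> ('k ^ 3 \<Rightarrow> 'k ^ 3) \<Rightarrow> 'k foliation \<Rightarrow> bool" where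
  "generates_at p V F \<longleftrightarrow>
     analytic_map_at p V \<and> (\<forall>\<^sub>F x in nhds p. V x \<noteq> 0 \<and> F x = vec.span {V x})"

text \<open>
  The injectivity clause makes the condition linear independence of the family
  \<open>(V l x)\<close>, \<open>l \<in> S\<close>, rather than of its set of values.
\<close>
definition web_germ :: "'k::real_normed_field ^ 3 \<Rightarrow> 'k web \<Rightarrow> bool" where
  "web_germ p F \<longleftrightarrow>
     (\<exists>V. (\<forall>l. generates_at p (V l) (F l)) \<and>
          (\<forall>\<^sub>F x in nhds p. \<forall>S. card S = 3 \<longrightarrow>
             inj_on (\<lambda>l. V l x) S \<and> vec.independent ((\<lambda>l. V l x) ` S)))"

type_synonym 'k two_form = "'k ^ 3 \<Rightarrow> 'k ^ 3 \<Rightarrow> 'k ^ 3 \<Rightarrow> 'k"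

definition alternating_bilinear ::
  "('k::field ^ 'n \<Rightarrow> 'k ^ 'n \<Rightarrow> 'k) \<Rightarrow> bool" where
  "alternating_bilinear b \<longleftrightarrow>
     (\<forall>v. Vector_Spaces.linear (*s) (*) (\<lambda>u. b u v)) \<and>
     (\<forall>u. Vector_Spaces.linear (*s) (*) (\<lambda>v. b u v)) \<and>
     (\<forall>u. b u u = 0)"

definition two_form_germ :: "'k::real_normed_field ^ 3 \<Rightarrow> 'k two_form \<Rightarrow> bool" where
  "two_form_germ p \<eta> \<longleftrightarrow>
     (\<forall>\<^sub>F x in nhds p. alternating_bilinear (\<eta> x)) \<and>
     (\<forall>u v. analytic_fun_at p (\<lambda>x. \<eta> x u v))"

text \<open>
  \<open>(L\<^sub>w \<eta>)(X, Y) = w(\<eta>(X, Y)) - \<eta>([w, X], Y) - \<eta>(X, [w, Y])\<close> evaluated on the constant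
  fields \<open>X = u\<close>, \<open>Y = v\<close>, for which \<open>[w, u] = - Dw(u)\<close>.  The real Frechet derivative
  of a holomorphic map is its complex derivative.
\<close>
definition lie_derivative ::
  "('k::real_normed_field ^ 3 \<Rightarrow> 'k ^ 3) \<Rightarrow> 'k two_form \<Rightarrow> 'k two_form" where
  "lie_derivative w \<eta> x u v =
     frechet_derivative (\<lambda>y. \<eta> y u v) (at x) (w x)
     + \<eta> x (frechet_derivative w (at x) u) v
     + \<eta> x u (frechet_derivative w (at x) v)"

definition basic_germ ::
  "'k::real_normed_field ^ 3 \<Rightarrow> 'k foliation \<Rightarrow> 'k two_form \<Rightarrow> bool" where
  "basic_germ p F \<eta> \<longleftrightarrow>
     (\<forall>w. analytic_map_at p w \<and> (\<forall>\<^sub>F x in nhds p. w x \<in> F x) \<longrightarrow>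
        (\<forall>\<^sub>F x in nhds p. \<forall>v. \<eta> x (w x) v = 0) \<and>
        (\<forall>\<^sub>F x in nhds p. \<forall>u v. lie_derivative w \<eta> x u v = 0))"

definition abelian_relation ::
  "'k::real_normed_field ^ 3 \<Rightarrow> 'k web \<Rightarrow> (4 \<Rightarrow> 'k two_form) \<Rightarrow> bool" where
  "abelian_relation p F \<eta> \<longleftrightarrow>
     (\<forall>l. two_form_germ p (\<eta> l) \<and> basic_germ p (F l) (\<eta> l)) \<and>
     (\<forall>\<^sub>F x in nhds p. \<forall>u v. (\<Sum>l\<in>UNIV. \<eta> l x u v) = 0)"

text \<open>Linear independence over \<open>'k\<close> of the germs at \<open>p\<close> of \<open>R 0, \<dots>, R (n - 1)\<close>.\<close>
definition independent_germs ::
  "'k::real_normed_field ^ 3 \<Rightarrow> nat \<Rightarrow> (nat \<Rightarrow> 4 \<Rightarrow> 'k two_form) \<Rightarrow> bool" where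
  "independent_germs p n R \<longleftrightarrow>
     (\<forall>c :: nat \<Rightarrow> 'k.
        (\<forall>\<^sub>F x in nhds p. \<forall>l u v. (\<Sum>i<n. c i * R i l x u v) = 0) \<longrightarrow> (\<forall>i<n. c i = 0))"

text \<open>The dimension over \<open>'k\<close> of the space of germs at \<open>p\<close> of abelian relations.\<close>
definition web_rank :: "'k::real_normed_field ^ 3 \<Rightarrow> 'k web \<Rightarrow> enat" where
  "web_rank p F =
     Sup {enat n | n. \<exists>R. (\<forall>i<n. abelian_relation p F (R i)) \<and> independent_germs p n R}"

definition rank_one_web_germs :: "(('k::real_normed_field ^ 3) \<times> 'k web) set" where
  "rank_one_web_germs = {(p, F). web_germ p F \<and> web_rank p F = 1}"

text \<open>
  Isomorphisms may permute the four foliations.  Two representatives of the same germ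
  are related by the identity, so classes of representatives are classes of germs.
\<close>
definition web_germ_isomorphic ::
  "('k::real_normed_field ^ 3) \<times> 'k web \<Rightarrow> ('k ^ 3) \<times> 'k web \<Rightarrow> bool" where
  "web_germ_isomorphic = (\<lambda>(p, F) (q, G). \<exists>\<phi> \<psi> \<sigma>.
     analytic_map_at p \<phi> \<and> \<phi> p = q \<and> analytic_map_at q \<psi> \<and> \<psi> q = p \<and>
     (\<forall>\<^sub>F x in nhds p. \<psi> (\<phi> x) = x) \<and> (\<forall>\<^sub>F y in nhds q. \<phi> (\<psi> y) = y) \<and>
     bij \<sigma> \<and>
     (\<forall>\<^sub>F x in nhds p. \<forall>l. frechet_derivative \<phi> (at x) ` F l x = G (\<sigma> l) (\<phi> x)))"

definition rank_one_web_iso ::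
  "((('k::real_normed_field ^ 3) \<times> 'k web) \<times> (('k ^ 3) \<times> 'k web)) set" where
  "rank_one_web_iso =
     {(W, W'). W \<in> rank_one_web_germs \<and> W' \<in> rank_one_web_germs \<and> web_germ_isomorphic W W'}"

end

theory Submission
  imports Defs
begin

text \<open>
  For a parameter \<open>t\<close> let \<open>W\<^sub>t\<close> be the web at the origin of \<open>'k\<^sup>3\<close> generated by
  \<open>V\<^sub>1 = \<partial>\<^sub>x\<close>, \<open>V\<^sub>2 = \<partial>\<^sub>y\<close>, \<open>V\<^sub>3 = \<partial>\<^sub>z + y \<partial>\<^sub>x + t x \<partial>\<^sub>y\<close> and \<open>V\<^sub>4 = - (V\<^sub>1 + V\<^sub>2 + V\<^sub>3)\<close>.
  The four fields are divergence free and sum to zero, so their contractions with the volume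
  form are closed and form an abelian relation (\<open>web_form_abelian_relation\<close>).  Any abelian
  relation is a multiple of this one by a function that is constant along the four foliations
  (\<open>abelian_relation_multiple\<close>), so the rank is exactly one (\<open>web_rank_web\<close>).

  A germ of differentiable map over \<open>'k\<close> fixing the origin and carrying each foliation of \<open>W\<^sub>t\<close> to the foliation of
  \<open>W\<^sub>s\<close> with the same index exists only if \<open>s = t\<close> (\<open>web_rigidity\<close>).  Conceptually, it
  multiplies the generators by a common function, which is constant because both structures
  are unimodular, and a constant factor cannot match the brackets \<open>[V\<^sub>2, V\<^sub>3] = V\<^sub>1\<close> and
  \<open>[V\<^sub>1, V\<^sub>3] = t V\<^sub>2\<close> of different parameters.  The proof below uses first derivatives only.
  Since an isomorphism may permute the foliations, each class can contain finitely many of the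
  webs \<open>W\<^sub>t\<close> (\<open>finite_isomorphic_webs\<close>), whereas there are uncountably many parameters.

  The real and the complex case are treated together, for a field that is a Euclidean space.
  What is needed about power series in several variables is that their sums
  have a \<open>'k\<close>-linear derivative near the centre (\<open>analytic_fun_at_has_linear_derivative\<close>).
\<close>

section \<open>Convergent power series are differentiable\<close>

text \<open>
  Termwise differentiation under a summable bound on the operator norms of the derivatives:
  the Weierstrass test makes the tails of the differentiated series small uniformly in the
  point and in the direction.
\<close>
lemma has_derivative_sums_Weierstrass:
  fixes f :: "nat \<Rightarrow> 'a::real_normed_vector \<Rightarrow> 'b::banach"
  assumes S: "open S" "convex S"
    and deriv: "\<And>n x. x \<in> S \<Longrightarrow> (f n has_derivative f' n x) (at x)"
    and bound: "\<And>n x h. x \<in> S \<Longrightarrow> norm (f' n x h) \<le> M n * norm h"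
    and M: "summable M"
    and sums: "\<And>x. x \<in> S \<Longrightarrow> (\<lambda>n. f n x) sums F x"
    and x: "x \<in> S"
  shows "(\<lambda>n. f' n x h) sums (\<Sum>n. f' n x h)"
    and "(F has_derivative (\<lambda>h. \<Sum>n. f' n x h)) (at x)"
proof -
  have summ: "summable (\<lambda>n. norm (f' n y h))" if "y \<in> S" for y h
    by (rule summable_comparison_test[where g="\<lambda>n. M n * norm h"])
      (use bound[OF that] summable_mult2[OF M] in auto)
  show "(\<lambda>n. f' n x h) sums (\<Sum>n. f' n x h)"
    using summable_norm_cancel[OF summ[OF x]] by (rule summable_sums)
  \<comment> \<open>the tail of the differentiated series is dominated by the tail of \<open>M\<close>\<close>
  have unif: "\<forall>\<^sub>F n in sequentially. \<forall>y\<in>S. \<forall>h. norm ((\<Sum>i<n. f' i y h) - (\<Sum>i. f' i y h)) \<le> e * norm h"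
    if "e > 0" for e :: real
  proof -
    obtain N where N: "\<And>n. n \<ge> N \<Longrightarrow> norm (\<Sum>i. M (i + n)) < e"
      using suminf_exist_split[OF \<open>e > 0\<close> M] by auto
    have "norm ((\<Sum>i<n. f' i y h) - (\<Sum>i. f' i y h)) \<le> e * norm h" if "n \<ge> N" "y \<in> S" for n y h
    proof -
      have s: "summable (\<lambda>i. norm (f' (i + n) y h))"
        using summ[OF \<open>y \<in> S\<close>] by (rule summable_ignore_initial_segment)
      have m: "summable (\<lambda>i. M (i + n))"
        using M by (rule summable_ignore_initial_segment)
      have "norm ((\<Sum>i<n. f' i y h) - (\<Sum>i. f' i y h)) = norm (\<Sum>i. f' (i + n) y h)"
        using suminf_split_initial_segment[OF summable_norm_cancel[OF summ[OF \<open>y \<in> S\<close>]], of h n]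
        by (metis add_diff_cancel_right' norm_minus_commute)
      also have "\<dots> \<le> (\<Sum>i. norm (f' (i + n) y h))"
        by (rule summable_norm[OF s])
      also have "\<dots> \<le> (\<Sum>i. M (i + n) * norm h)"
        by (rule suminf_le) (use bound[OF \<open>y \<in> S\<close>] s summable_mult2[OF m] in auto)
      also have "\<dots> = (\<Sum>i. M (i + n)) * norm h"
        by (rule suminf_mult2[OF m, symmetric])
      also have "\<dots> \<le> e * norm h"
        by (rule mult_right_mono) (use N[OF \<open>n \<ge> N\<close>] in auto)
      finally show ?thesis .
    qed
    then show ?thesis unfolding eventually_sequentially by blast
  qed
  have "\<exists>g. \<forall>y\<in>S. (\<lambda>n. f n y) sums g y \<and> (g has_derivative (\<lambda>h. \<Sum>n. f' n y h)) (at y within S)"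
  proof (rule has_derivative_series[where f=f and f'=f' and x=x, OF S(2) _ _ x sums[OF x]])
    show "(f n has_derivative f' n y) (at y within S)" if "y \<in> S" for n y
      using deriv[OF that] by (rule has_derivative_at_withinI)
  qed (rule unif)
  then obtain g where g: "\<forall>y\<in>S. (\<lambda>n. f n y) sums g y \<and> (g has_derivative (\<lambda>h. \<Sum>n. f' n y h)) (at y within S)"
    by (rule exE)
  have gF: "g y = F y" if "y \<in> S" for y
    using g that sums[OF that] by (metis sums_unique2)
  have "(g has_derivative (\<lambda>h. \<Sum>n. f' n x h)) (at x)"
    using g x at_within_open[OF x S(1)] by metis
  then show "(F has_derivative (\<lambda>h. \<Sum>n. f' n x h)) (at x)"
    by (rule has_derivative_transform_within_open[OF _ S(1) x]) (rule gF)
qed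

lemma summable_on_imp_abs_summable_on_euclidean:
  fixes f :: "'a \<Rightarrow> 'b::euclidean_space"
  assumes "f summable_on A"
  shows "(\<lambda>x. norm (f x)) summable_on A"
proof -
  have *: "(\<lambda>x. \<bar>f x \<bullet> b\<bar>) summable_on A" for b
    using summable_on_iff_abs_summable_on_real[THEN iffD1,
      OF summable_on_bounded_linear[OF bounded_linear_inner_left assms, of b]] by simp
  have "(\<lambda>x. \<Sum>b\<in>B. \<bar>f x \<bullet> b\<bar>) summable_on A" if "finite B" for B
    using that by (induction B rule: finite_induct) (auto intro: summable_on_add *)
  from this[OF finite_Basis] have "(\<lambda>x. \<Sum>b\<in>Basis. \<bar>f x \<bullet> b\<bar>) summable_on A" .
  then show ?thesis
    by (rule summable_on_comparison_test) (auto intro: norm_le_l1)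
qed

definition monomial_at :: "'k::real_normed_field ^ 'n \<Rightarrow> ('n \<Rightarrow> nat) \<Rightarrow> 'k ^ 'n \<Rightarrow> 'k" where
  "monomial_at p \<alpha> x = (\<Prod>i\<in>UNIV. (x $ i - p $ i) ^ \<alpha> i)"

definition monomial_deriv :: "'k::real_normed_field ^ 'n \<Rightarrow> ('n \<Rightarrow> nat) \<Rightarrow> 'k ^ 'n \<Rightarrow> 'k ^ 'n \<Rightarrow> 'k" where
  "monomial_deriv p \<alpha> x h = (\<Sum>i\<in>UNIV. (of_nat (\<alpha> i) * (h $ i * (x $ i - p $ i) ^ (\<alpha> i - 1)))
      * (\<Prod>j\<in>UNIV - {i}. (x $ j - p $ j) ^ \<alpha> j))"

lemma has_derivative_monomial_at:
  "(monomial_at p \<alpha> has_derivative monomial_deriv p \<alpha> x) (at x)"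
proof -
  have "((\<lambda>x. x $ i - p $ i) has_derivative (\<lambda>h. h $ i)) (at x)" for i
    by (auto intro!: derivative_eq_intros bounded_linear_imp_has_derivative bounded_linear_vec_nth)
  from has_derivative_power[OF this] have "((\<lambda>x. \<Prod>i\<in>UNIV. (x $ i - p $ i) ^ \<alpha> i) has_derivative monomial_deriv p \<alpha> x) (at x)"
    unfolding monomial_deriv_def by (intro has_derivative_prod) (simp add: mult.assoc)
  then show ?thesis unfolding monomial_at_def[abs_def] .
qed

text \<open>
  Halving the radius pays for the factor \<open>m = \<bar>\<alpha>\<bar>\<close> that differentiation produces, because
  \<open>m \<le> 2 ^ m\<close>; the resulting bound is, up to a constant, the absolute value of the monomial
  itself at a point of the polydisc of radius \<open>\<rho>\<close>.
\<close>
lemma norm_monomial_deriv_le: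
  fixes p :: "'k::real_normed_field ^ 'n"
  assumes x: "\<And>i. norm (x $ i - p $ i) \<le> \<rho> / 2" and \<rho>: "\<rho> > 0"
  shows "norm (monomial_deriv p \<alpha> x h) \<le> (2 / \<rho> * \<rho> ^ (\<Sum>i\<in>UNIV. \<alpha> i)) * norm h"
proof -
  define m where "m = (\<Sum>i\<in>UNIV. \<alpha> i)"
  have "norm (of_nat (\<alpha> i) * (h $ i * (x $ i - p $ i) ^ (\<alpha> i - 1))
      * (\<Prod>j\<in>UNIV - {i}. (x $ j - p $ j) ^ \<alpha> j)) \<le> real (\<alpha> i) * (norm h * (\<rho> / 2) ^ (m - 1))" for i
  proof (cases "\<alpha> i = 0")
    case False
    have m: "m = \<alpha> i + (\<Sum>j\<in>UNIV - {i}. \<alpha> j)"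
      unfolding m_def by (subst sum.remove[of _ i]) auto
    have "(\<Prod>j\<in>UNIV - {i}. norm (x $ j - p $ j) ^ \<alpha> j) \<le> (\<Prod>j\<in>UNIV - {i}. (\<rho> / 2) ^ \<alpha> j)"
      by (intro prod_mono) (auto intro!: power_mono x)
    also have "\<dots> = (\<rho> / 2) ^ (\<Sum>j\<in>UNIV - {i}. \<alpha> j)"
      by (simp add: power_sum)
    finally have 1: "(\<Prod>j\<in>UNIV - {i}. norm (x $ j - p $ j) ^ \<alpha> j) \<le> (\<rho> / 2) ^ (\<Sum>j\<in>UNIV - {i}. \<alpha> j)" .
    have "norm (of_nat (\<alpha> i) * (h $ i * (x $ i - p $ i) ^ (\<alpha> i - 1))
      * (\<Prod>j\<in>UNIV - {i}. (x $ j - p $ j) ^ \<alpha> j)) =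
      real (\<alpha> i) * (norm (h $ i) * norm (x $ i - p $ i) ^ (\<alpha> i - 1)) * (\<Prod>j\<in>UNIV - {i}. norm (x $ j - p $ j) ^ \<alpha> j)"
      by (simp add: norm_mult norm_power prod_norm[symmetric])
    also have "\<dots> \<le> real (\<alpha> i) * (norm h * (\<rho> / 2) ^ (\<alpha> i - 1)) * (\<rho> / 2) ^ (\<Sum>j\<in>UNIV - {i}. \<alpha> j)"
      by (intro mult_mono 1 power_mono x)
        (use \<rho> in \<open>auto simp: Finite_Cartesian_Product.norm_nth_le intro!: prod_nonneg mult_nonneg_nonneg\<close>)
    also have "\<dots> = real (\<alpha> i) * (norm h * (\<rho> / 2) ^ (m - 1))"
      using False by (simp add: m power_add[symmetric])
    finally show ?thesis .
  qed simp
  then have "norm (monomial_deriv p \<alpha> x h) \<le> (\<Sum>i\<in>UNIV. real (\<alpha> i) * (norm h * (\<rho> / 2) ^ (m - 1)))"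
    unfolding monomial_deriv_def by (intro norm_sum[THEN order_trans] sum_mono)
  also have "\<dots> = real m * (\<rho> / 2) ^ (m - 1) * norm h"
    by (simp add: m_def sum_distrib_right[symmetric])
  also have "\<dots> \<le> (2 / \<rho> * \<rho> ^ m) * norm h"
  proof (rule mult_right_mono)
    have "real m * (\<rho> / 2) ^ (m - 1) = 2 / \<rho> * \<rho> ^ m * (real m / 2 ^ m)"
      using \<rho> by (cases m) (auto simp: field_simps)
    also have "\<dots> \<le> 2 / \<rho> * \<rho> ^ m * 1"
    proof (rule mult_left_mono)
      have "real m \<le> 2 ^ m"
        using less_imp_le[OF less_exp[of m]] by (metis of_nat_le_iff of_nat_numeral of_nat_power)
      then show "real m / 2 ^ m \<le> 1" by simp
    qed (use \<rho> in auto)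
    finally show "real m * (\<rho> / 2) ^ (m - 1) \<le> 2 / \<rho> * \<rho> ^ m" by simp
  qed simp
  finally show ?thesis unfolding m_def .
qed

text \<open>
  Summability at the single point whose coordinates all differ from those of \<open>p\<close> by \<open>\<rho>\<close>
  controls the differentiated series on the ball of radius \<open>\<rho> / 2\<close>.  Linearity of the
  derivative over \<open>'k\<close>, not only over the reals, is what excludes complex conjugation as an
  isomorphism between complex webs.
\<close>
lemma analytic_fun_at_has_linear_derivative:
  fixes f :: "'k::{real_normed_field,euclidean_space} ^ 'n \<Rightarrow> 'k"
  assumes "analytic_fun_at p f"
  shows "\<forall>\<^sub>F x in nhds p. \<exists>D. (f has_derivative D) (at x) \<and> (\<forall>c u. D (c *s u) = c * D u)"
proof -
  obtain c where "\<forall>\<^sub>F x in nhds p. ((\<lambda>\<alpha>. c \<alpha> * monomial_at p \<alpha> x) has_sum f x) UNIV"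
    using assms unfolding analytic_fun_at_def monomial_at_def by blast
  then obtain e where "e > 0" and e: "\<And>x. dist x p < e \<Longrightarrow> ((\<lambda>\<alpha>. c \<alpha> * monomial_at p \<alpha> x) has_sum f x) UNIV"
    unfolding eventually_nhds_metric by blast
  \<comment> \<open>small enough for the corner \<open>q\<close> of the polydisc to lie in the ball of radius \<open>e\<close>\<close>
  define \<rho> where "\<rho> = e / (2 * real CARD('n))"
  have \<rho>: "\<rho> > 0" unfolding \<rho>_def using \<open>e > 0\<close> by simp
  define q where "q = p + (\<chi> i. of_real \<rho>)"
  have "norm (q - p) \<le> (\<Sum>i\<in>(UNIV::'n set). \<rho>)"
    unfolding norm_vec_def by (rule order_trans[OF L2_set_le_sum]) (use \<rho> in \<open>auto simp: q_def\<close>)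
  also have "\<dots> < e" using \<open>e > 0\<close> by (simp add: \<rho>_def)
  finally have "dist q p < e" by (simp add: dist_norm)
  from has_sum_imp_summable[OF e[OF this]]
  have "(\<lambda>\<alpha>. norm (c \<alpha> * monomial_at p \<alpha> q)) summable_on UNIV"
    by (rule summable_on_imp_abs_summable_on_euclidean)
  moreover have "norm (monomial_at p \<alpha> q) = \<rho> ^ (\<Sum>i\<in>UNIV. \<alpha> i)" for \<alpha>
    unfolding monomial_at_def q_def using \<rho>
    by (simp add: prod_norm[symmetric] norm_power power_sum)
  ultimately have summ: "(\<lambda>\<alpha>. norm (c \<alpha>) * \<rho> ^ (\<Sum>i\<in>UNIV. \<alpha> i)) summable_on UNIV"
    by (simp add: norm_mult)
  have "inj (\<lambda>n (_::'n). n :: nat)" by (auto simp: inj_def fun_eq_iff)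
  then have inf: "infinite (UNIV :: ('n \<Rightarrow> nat) set)"
    using finite_imageD[of _ UNIV] infinite_UNIV_nat by (metis finite_subset subset_UNIV)
  define g :: "nat \<Rightarrow> 'n \<Rightarrow> nat" where "g = from_nat_into UNIV"
  have g: "bij_betw g UNIV UNIV"
    unfolding g_def by (rule bij_betw_from_nat_into) (use inf in auto)
  define M where "M n = norm (c (g n)) * (2 / \<rho> * \<rho> ^ (\<Sum>i\<in>UNIV. g n i))" for n
  have "(\<lambda>n. norm (c (g n)) * \<rho> ^ (\<Sum>i\<in>UNIV. g n i)) summable_on UNIV"
    using summable_on_reindex_bij_betw[OF g, of "\<lambda>\<alpha>. norm (c \<alpha>) * \<rho> ^ (\<Sum>i\<in>UNIV. \<alpha> i)"] summ by simp
  then have "summable (\<lambda>n. norm (c (g n)) * \<rho> ^ (\<Sum>i\<in>UNIV. g n i))"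
    by (rule summable_on_imp_summable)
  from summable_mult[OF this, of "2 / \<rho>"] have M: "summable M"
    unfolding M_def by (simp add: mult_ac)
  define r where "r = min e (\<rho> / 2)"
  have "r > 0" unfolding r_def using \<open>e > 0\<close> \<rho> by simp
  define S where "S = ball p r"
  have S: "open S" "convex S" "p \<in> S" unfolding S_def using \<open>r > 0\<close> by auto
  have bound: "norm (c (g n) * monomial_deriv p (g n) x h) \<le> M n * norm h" if "x \<in> S" for n x h
  proof -
    have "norm (x $ i - p $ i) \<le> \<rho> / 2" for i
      using that Finite_Cartesian_Product.norm_nth_le[of "x - p" i] unfolding S_def r_def
      by (simp add: dist_norm norm_minus_commute)
    then have "norm (c (g n)) * norm (monomial_deriv p (g n) x h)
        \<le> norm (c (g n)) * ((2 / \<rho> * \<rho> ^ (\<Sum>i\<in>UNIV. g n i)) * norm h)"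
      by (intro mult_left_mono norm_monomial_deriv_le \<rho>) auto
    then show ?thesis unfolding M_def by (simp add: norm_mult mult.assoc)
  qed
  have sums: "(\<lambda>n. c (g n) * monomial_at p (g n) x) sums f x" if "x \<in> S" for x
  proof (rule has_sum_imp_sums)
    have "dist x p < e" using that unfolding S_def r_def by (simp add: dist_commute)
    then show "((\<lambda>n. c (g n) * monomial_at p (g n) x) has_sum f x) UNIV"
      using has_sum_reindex_bij_betw[OF g, of "\<lambda>\<alpha>. c \<alpha> * monomial_at p \<alpha> x" "f x"] e by simp
  qed
  have deriv: "((\<lambda>x. c (g n) * monomial_at p (g n) x) has_derivative
      (\<lambda>h. c (g n) * monomial_deriv p (g n) x h)) (at x)" for n x
    by (rule has_derivative_mult_right[OF has_derivative_monomial_at])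
  have "\<exists>D. (f has_derivative D) (at x) \<and> (\<forall>c u. D (c *s u) = c * D u)" if "x \<in> S" for x
  proof (intro exI conjI allI)
    let ?D = "\<lambda>h. \<Sum>n. c (g n) * monomial_deriv p (g n) x h"
    note W = has_derivative_sums_Weierstrass[OF S(1,2) deriv bound M sums that]
    show "(f has_derivative ?D) (at x)" by (rule W(2))
    fix a u
    have "monomial_deriv p \<alpha> x (a *s u) = a * monomial_deriv p \<alpha> x u" for \<alpha>
      unfolding monomial_deriv_def by (simp add: sum_distrib_left mult_ac)
    then have "(\<lambda>n. c (g n) * monomial_deriv p (g n) x (a *s u)) sums (a * ?D u)"
      using sums_mult[OF W(1), of a] by (simp add: mult_ac)
    then show "?D (a *s u) = a * ?D u" by (simp add: sums_iff)
  qed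
  then show ?thesis
    by (rule eventually_mono[OF eventually_nhds_in_open[OF S(1,3)]])
qed

lemma analytic_fun_at_const: "analytic_fun_at p (\<lambda>x. a)"
  unfolding analytic_fun_at_def
proof (intro exI always_eventually allI)
  show "((\<lambda>\<alpha>. (if \<alpha> = (\<lambda>_. 0) then a else 0) * (\<Prod>i\<in>UNIV. (x $ i - p $ i) ^ \<alpha> i)) has_sum a) UNIV" for x
    by (rule has_sum_finite_neutralI[of "{\<lambda>_. 0}"]) auto
qed

lemma analytic_fun_at_add:
  assumes "analytic_fun_at p f" "analytic_fun_at p g"
  shows "analytic_fun_at p (\<lambda>x. f x + g x)"
proof -
  obtain c d where
    "\<forall>\<^sub>F x in nhds p. ((\<lambda>\<alpha>. c \<alpha> * (\<Prod>i\<in>UNIV. (x $ i - p $ i) ^ \<alpha> i)) has_sum f x) UNIV"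
    "\<forall>\<^sub>F x in nhds p. ((\<lambda>\<alpha>. d \<alpha> * (\<Prod>i\<in>UNIV. (x $ i - p $ i) ^ \<alpha> i)) has_sum g x) UNIV"
    using assms unfolding analytic_fun_at_def by blast
  then have "\<forall>\<^sub>F x in nhds p.
      ((\<lambda>\<alpha>. (c \<alpha> + d \<alpha>) * (\<Prod>i\<in>UNIV. (x $ i - p $ i) ^ \<alpha> i)) has_sum (f x + g x)) UNIV"
    by eventually_elim (simp add: distrib_right has_sum_add)
  then show ?thesis unfolding analytic_fun_at_def by (intro exI)
qed

lemma analytic_fun_at_cmult:
  assumes "analytic_fun_at p f"
  shows "analytic_fun_at p (\<lambda>x. a * f x)"
proof -
  obtain c where
    "\<forall>\<^sub>F x in nhds p. ((\<lambda>\<alpha>. c \<alpha> * (\<Prod>i\<in>UNIV. (x $ i - p $ i) ^ \<alpha> i)) has_sum f x) UNIV"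
    using assms unfolding analytic_fun_at_def by blast
  then have "\<forall>\<^sub>F x in nhds p.
      ((\<lambda>\<alpha>. (a * c \<alpha>) * (\<Prod>i\<in>UNIV. (x $ i - p $ i) ^ \<alpha> i)) has_sum (a * f x)) UNIV"
    by eventually_elim (simp add: mult.assoc has_sum_cmult_right)
  then show ?thesis unfolding analytic_fun_at_def by (intro exI)
qed

lemma analytic_fun_at_coordinate: "analytic_fun_at p (\<lambda>x. x $ i)"
proof -
  define \<delta> where "\<delta> = (\<lambda>j. if j = i then 1 else 0 :: nat)"
  have "((\<lambda>\<alpha>. (if \<alpha> = \<delta> then 1 else 0) * (\<Prod>j\<in>UNIV. (x $ j - p $ j) ^ \<alpha> j)) has_sum (x $ i - p $ i)) UNIV" for x
  proof (rule has_sum_finite_neutralI[of "{\<delta>}"])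
    have "(\<Prod>j\<in>UNIV. (x $ j - p $ j) ^ \<delta> j) = (\<Prod>j\<in>UNIV. if j = i then x $ j - p $ j else 1)"
      by (intro prod.cong) (auto simp: \<delta>_def)
    then show "x $ i - p $ i = (\<Sum>\<alpha>\<in>{\<delta>}. (if \<alpha> = \<delta> then 1 else 0) * (\<Prod>j\<in>UNIV. (x $ j - p $ j) ^ \<alpha> j))"
      by simp
  qed auto
  then have "analytic_fun_at p (\<lambda>x. x $ i - p $ i)"
    unfolding analytic_fun_at_def
    by (intro exI[of _ "\<lambda>\<alpha>. if \<alpha> = \<delta> then 1 else 0"] always_eventually allI)
  from analytic_fun_at_add[OF this analytic_fun_at_const[of p "p $ i"]] show ?thesis by simp
qed

lemma has_derivative_vec_nth [derivative_intros]:
  "(f has_derivative D) F \<Longrightarrow> ((\<lambda>x. f x $ i) has_derivative (\<lambda>h. D h $ i)) F"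
  by (rule bounded_linear.has_derivative[OF bounded_linear_vec_nth])

lemma has_derivative_vecI:
  fixes f :: "'a::euclidean_space \<Rightarrow> 'k::euclidean_space ^ 'm"
  assumes "\<And>i. ((\<lambda>x. f x $ i) has_derivative (\<lambda>h. D h $ i)) (at a)"
  shows "(f has_derivative D) (at a)"
  unfolding has_derivative_componentwise_within[of f D a UNIV]
proof
  fix b :: "'k ^ 'm" assume "b \<in> Basis"
  then obtain i u where "b = axis i u" by (auto simp: Basis_vec_def)
  then show "((\<lambda>x. f x \<bullet> b) has_derivative (\<lambda>x. D x \<bullet> b)) (at a)"
    using has_derivative_inner_left[OF assms[of i], of u] by (simp add: inner_axis)
qed

lemma analytic_map_at_has_linear_derivative:
  fixes f :: "'k::{real_normed_field,euclidean_space} ^ 'n \<Rightarrow> 'k ^ 'm"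
  assumes "analytic_map_at p f"
  shows "\<forall>\<^sub>F x in nhds p. \<exists>D. (f has_derivative D) (at x) \<and> (\<forall>c u. D (c *s u) = c *s D u)"
proof -
  have "\<forall>\<^sub>F x in nhds p. \<forall>i. \<exists>D. ((\<lambda>x. f x $ i) has_derivative D) (at x) \<and> (\<forall>c u. D (c *s u) = c * D u)"
  proof (rule eventually_all_finite)
    show "\<forall>\<^sub>F x in nhds p. \<exists>D. ((\<lambda>x. f x $ i) has_derivative D) (at x) \<and> (\<forall>c u. D (c *s u) = c * D u)" for i
      by (rule analytic_fun_at_has_linear_derivative) (use assms in \<open>simp add: analytic_map_at_def\<close>)
  qed
  then show ?thesis
  proof eventually_elim
    case (elim x)
    from choice[OF this] obtain D where D: "\<And>i. ((\<lambda>x. f x $ i) has_derivative D i) (at x)"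
        "\<And>i c u. D i (c *s u) = c * D i u"
      by auto
    have "(f has_derivative (\<lambda>h. \<chi> i. D i h)) (at x)"
      by (rule has_derivative_vecI) (simp add: D(1))
    then show ?case
      by (intro exI[of _ "\<lambda>h. \<chi> i. D i h"]) (simp add: D(2) vec_eq_iff)
  qed
qed


section \<open>The one-parameter family of webs\<close>

text \<open>
  The fields \<open>\<partial>\<^sub>x\<close>, \<open>\<partial>\<^sub>y\<close>, \<open>\<partial>\<^sub>z + y \<partial>\<^sub>x + t x \<partial>\<^sub>y\<close> and minus their sum.  The first three span
  the Lie algebra of the group \<open>'k \<ltimes> 'k\<^sup>2\<close> in which \<open>'k\<close> acts through the traceless matrix
  with rows \<open>(0, 1)\<close> and \<open>(t, 0)\<close>; the trace being zero makes all four fields divergence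
  free.
\<close>
definition web_field :: "'k::real_normed_field \<Rightarrow> 4 \<Rightarrow> 'k ^ 3 \<Rightarrow> 'k ^ 3" where
  "web_field t l x =
     (if l = 1 then vector [1, 0, 0]
      else if l = 2 then vector [0, 1, 0]
      else if l = 3 then vector [x $ 2, t * x $ 1, 1]
      else vector [- 1 - x $ 2, - 1 - t * x $ 1, - 1])"

definition web :: "'k::real_normed_field \<Rightarrow> 'k web" where
  "web t l x = vec.span {web_field t l x}"

text \<open>
  The linear part of the field, which is affine in \<open>x\<close>.
\<close>
definition web_field_deriv :: "'k::real_normed_field \<Rightarrow> 4 \<Rightarrow> 'k ^ 3 \<Rightarrow> 'k ^ 3" where
  "web_field_deriv t l u =
     (if l = 1 \<or> l = 2 then 0
      else if l = 3 then vector [u $ 2, t * u $ 1, 0]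
      else vector [- u $ 2, - (t * u $ 1), 0])"

lemma web_field_nth:
  "web_field t 1 x = vector [1, 0, 0]"
  "web_field t 2 x = vector [0, 1, 0]"
  "web_field t 3 x = vector [x $ 2, t * x $ 1, 1]"
  "web_field t 4 x = vector [- 1 - x $ 2, - 1 - t * x $ 1, - 1]"
  by (simp_all add: web_field_def)

lemma web_field_deriv_nth:
  "web_field_deriv t 1 u = 0"
  "web_field_deriv t 2 u = 0"
  "web_field_deriv t 3 u = vector [u $ 2, t * u $ 1, 0]"
  "web_field_deriv t 4 u = vector [- u $ 2, - (t * u $ 1), 0]"
  by (simp_all add: web_field_deriv_def)

lemma sum_web_field: "(\<Sum>l\<in>UNIV. web_field t l x) = 0"
  unfolding sum_4 vec_eq_iff forall_3 by (simp add: web_field_nth)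

text \<open>
  The vanishing sum is the only linear relation between the four vectors; this is both the
  general position of the web and the reason why proportionality factors on the four
  foliations must agree with each other.
\<close>
lemma web_field_relation:
  assumes "(\<Sum>l\<in>UNIV. a l *s web_field t l x) = 0"
  shows "a l = a m"
proof -
  have "(\<Sum>l\<in>UNIV. a l *s web_field t l x) $ i = 0" for i
    using assms by simp
  from this[of 1] this[of 2] this[of 3]
  have *: "a 1 + a 3 * x $ 2 + a 4 * (- 1 - x $ 2) = 0"
      "a 2 + a 3 * (t * x $ 1) + a 4 * (- 1 - t * x $ 1) = 0" "a 3 - a 4 = 0"
    by (simp_all add: sum_4 web_field_nth)
  from *(3) have 3: "a 3 = a 4" by simp
  from *(1) have 1: "a 1 = a 4" unfolding 3 by (simp add: algebra_simps)
  from *(2) have 2: "a 2 = a 4" unfolding 3 by (simp add: algebra_simps)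
  have "a k = a 4" for k using exhaust_4[of k] 1 2 3 by metis
  then show ?thesis by metis
qed

lemma web_field_neq_0: "web_field t l x \<noteq> 0"
  using exhaust_4[of l] by (auto simp: web_field_nth vec_eq_iff forall_3)

lemma web_eq_range: "web t l x = range (\<lambda>c. c *s web_field t l x)"
  by (simp add: web_def vec.span_singleton)

lemma has_derivative_web_field:
  fixes t :: "'k::{real_normed_field,euclidean_space}"
  shows "(web_field t l has_derivative web_field_deriv t l) (at x)"
proof (rule has_derivative_vecI)
  fix i
  show "((\<lambda>x. web_field t l x $ i) has_derivative (\<lambda>h. web_field_deriv t l h $ i)) (at x)"
    using exhaust_4[of l] exhaust_3[of i]
    by (auto simp: web_field_nth web_field_deriv_nth) (auto intro!: derivative_eq_intros)
qed

lemma analytic_web_field: "analytic_map_at p (web_field t l)"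
  unfolding analytic_map_at_def
proof
  fix i
  have affine: "analytic_fun_at p (\<lambda>x. a + b * x $ j)" for a b :: 'a and j :: 3
    by (intro analytic_fun_at_add analytic_fun_at_cmult analytic_fun_at_const analytic_fun_at_coordinate)
  show "analytic_fun_at p (\<lambda>x. web_field t l x $ i)"
    using exhaust_4[of l] exhaust_3[of i]
      affine[of 0 1 2] affine[of 0 t 1] affine[of "-1" "-1" 2] affine[of "-1" "-t" 1]
    by (auto simp: web_field_nth analytic_fun_at_const)
qed

lemma web_germ_web: "web_germ 0 (web t)"
  unfolding web_germ_def
proof (intro exI conjI allI always_eventually impI)
  show "generates_at 0 (web_field t l) (web t l)" for l
    unfolding generates_at_def by (simp add: analytic_web_field web_field_neq_0 web_def)
next
  fix x :: "'a ^ 3" and S :: "4 set" assume "card S = 3"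
  then have "S \<noteq> UNIV" by auto
  then obtain m where m: "m \<notin> S" by auto
  have indep: "\<forall>l\<in>S. a l = 0" if "(\<Sum>l\<in>S. a l *s web_field t l x) = 0" for a
  proof -
    \<comment> \<open>a relation in which the index \<open>m\<close> is missing has all its coefficients equal to \<open>0\<close>\<close>
    have "(\<Sum>l\<in>UNIV. (if l \<in> S then a l else 0) *s web_field t l x) = (\<Sum>l\<in>S. a l *s web_field t l x)"
      by (rule sum.mono_neutral_cong_right) auto
    then have "(\<Sum>l\<in>UNIV. (if l \<in> S then a l else 0) *s web_field t l x) = 0"
      using that by simp
    from web_field_relation[OF this, of _ m] m have "(if l \<in> S then a l else 0) = 0" for l
      by simp
    then show ?thesis by meson
  qed
  show inj: "inj_on (\<lambda>l. web_field t l x) S"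
  proof (rule inj_onI, rule ccontr)
    fix l k assume lk: "l \<in> S" "k \<in> S" "web_field t l x = web_field t k x" "l \<noteq> k"
    have "(\<Sum>j\<in>S. (if j = l then 1 else if j = k then - 1 else 0) *s web_field t j x)
        = (\<Sum>j\<in>{l, k}. (if j = l then 1 else if j = k then - 1 else 0) *s web_field t j x)"
      by (rule sum.mono_neutral_right) (use lk in auto)
    also have "\<dots> = 0" using lk by simp
    finally show False using indep[of "\<lambda>j. if j = l then 1 else if j = k then - 1 else 0"] lk(1) by auto
  qed
  show "vec.independent ((\<lambda>l. web_field t l x) ` S)"
    unfolding vec.dependent_finite[OF finite_imageI[OF finite]]
  proof (rule notI)
    assume "\<exists>u. (\<exists>v\<in>(\<lambda>l. web_field t l x) ` S. u v \<noteq> 0) \<and> (\<Sum>v\<in>(\<lambda>l. web_field t l x) ` S. u v *s v) = 0"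
    then obtain u where u: "\<exists>l\<in>S. u (web_field t l x) \<noteq> 0"
        "(\<Sum>l\<in>S. u (web_field t l x) *s web_field t l x) = 0"
      by (auto simp: sum.reindex[OF inj])
    from indep[OF u(2)] u(1) show False by blast
  qed
qed

section \<open>The rank of these webs is one\<close>

abbreviation det_of :: "'k::comm_ring_1 ^ 3 \<Rightarrow> 'k ^ 3 \<Rightarrow> 'k ^ 3 \<Rightarrow> 'k" where
  "det_of a b c \<equiv> det (vector [a, b, c] :: 'k ^ 3 ^ 3)"

lemma det_of_eq: "det_of a b c = a $ 1 * (b $ 2 * c $ 3 - b $ 3 * c $ 2)
  + a $ 2 * (b $ 3 * c $ 1 - b $ 1 * c $ 3) + a $ 3 * (b $ 1 * c $ 2 - b $ 2 * c $ 1)"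
  by (simp add: det_3 algebra_simps)

lemma has_derivative_det_of:
  fixes V :: "'a::real_normed_vector \<Rightarrow> 'k::real_normed_field ^ 3"
  assumes "(V has_derivative D) F"
  shows "((\<lambda>x. det_of (V x) u v) has_derivative (\<lambda>h. det_of (D h) u v)) F"
  unfolding det_of_eq
  by (intro has_derivative_add has_derivative_mult_left has_derivative_vec_nth assms)

text \<open>
  For a linear map \<open>A\<close> the left-hand side has the form
  \<open>det (A a, u, v) + det (a, A u, v) + det (a, u, A v) = tr A * det (a, u, v)\<close>, and the linear
  parts of the four fields are traceless.
\<close>
lemma web_field_divergence_free:
  "det_of (web_field_deriv t l (web_field t l x)) u v + det_of (web_field t l x) (web_field_deriv t l u) v
    + det_of (web_field t l x) u (web_field_deriv t l v) = 0"
proof -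
  consider "l = 1" | "l = 2" | "l = 3" | "l = 4" using exhaust_4[of l] by blast
  then show ?thesis
    by cases (simp_all add: web_field_nth web_field_deriv_nth det_of_eq algebra_simps)
qed

text \<open>
  A field tangent to the foliation is a multiple of the generator; the multiplier is
  differentiable because it is, up to sign, a coordinate of the field: some coordinate of the
  generator is constantly \<open>1\<close> or \<open>-1\<close>.
\<close>
lemma web_section:
  fixes t :: "'k::{real_normed_field,euclidean_space}"
  assumes U: "open U" "x \<in> U" and w: "(w has_derivative W) (at x)"
    and mem: "\<And>y. y \<in> U \<Longrightarrow> w y \<in> web t l y"
  shows "\<exists>g G. w x = g *s web_field t l x \<and> (\<forall>u. W u = G u *s web_field t l x + g *s web_field_deriv t l u)"
proof -
  obtain k :: 3 and \<epsilon> where k: "\<And>y. web_field t l y $ k = \<epsilon>" "\<epsilon> * \<epsilon> = 1"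
  proof -
    consider "l = 1" | "l = 2" | "l = 3" | "l = 4" using exhaust_4[of l] by blast
    then show ?thesis
      by cases (use that[of 1 1] that[of 2 1] that[of 3 1] that[of 3 "-1"] in
        \<open>simp_all add: web_field_nth\<close>)
  qed
  define g where "g y = \<epsilon> * w y $ k" for y
  have wg: "g y *s web_field t l y = w y" if "y \<in> U" for y
  proof -
    from mem[OF that] obtain c where c: "w y = c *s web_field t l y" by (auto simp: web_eq_range)
    have "g y = c * (\<epsilon> * \<epsilon>)" unfolding g_def c by (simp add: k(1) mult.left_commute)
    then show ?thesis using c k(2) by simp
  qed
  define G where "G u = \<epsilon> * W u $ k" for u
  have G: "(g has_derivative G) (at x)"
    unfolding g_def G_def by (intro has_derivative_mult_right has_derivative_vec_nth w)
  have "((\<lambda>y. g y *s web_field t l y) has_derivative (\<lambda>u. G u *s web_field t l x + g x *s web_field_deriv t l u)) (at x)"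
  proof (rule has_derivative_vecI)
    fix i
    show "((\<lambda>y. (g y *s web_field t l y) $ i) has_derivative
        (\<lambda>u. (G u *s web_field t l x + g x *s web_field_deriv t l u) $ i)) (at x)"
      using has_derivative_mult[OF G has_derivative_vec_nth[OF has_derivative_web_field[of t l x], of i]]
      by (simp add: add.commute)
  qed
  from has_derivative_unique[OF w has_derivative_transform_within_open[OF this U wg]]
  have "W = (\<lambda>u. G u *s web_field t l x + g x *s web_field_deriv t l u)" .
  with wg[OF U(2)] show ?thesis by (intro exI[of _ "g x"] exI[of _ G]) simp
qed

text \<open>
  The form \<open>\<iota>\<^sub>V vol\<close> of a divergence free field \<open>V\<close> is closed, so by Cartan's formula its Lie
  derivative along any multiple \<open>w\<close> of \<open>V\<close> vanishes; what remains for \<open>f \<iota>\<^sub>V vol\<close> is the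
  derivative of \<open>f\<close> along \<open>w\<close>.  The case \<open>f = 1\<close> shows that the forms of the relation are
  basic, the case \<open>w = V\<close> that every other relation is a constant multiple of it.
\<close>
lemma lie_derivative_multiple:
  fixes t :: "'k::{real_normed_field,euclidean_space}"
  assumes U: "open U" "x \<in> U" and w: "(w has_derivative W) (at x)"
    and mem: "\<And>y. y \<in> U \<Longrightarrow> w y \<in> web t l y"
    and \<eta>: "\<And>y u v. y \<in> U \<Longrightarrow> \<eta> y u v = f y * det_of (web_field t l y) u v"
    and f: "(f has_derivative D) (at x)"
  shows "lie_derivative w \<eta> x u v = D (w x) * det_of (web_field t l x) u v"
proof -
  obtain g G where g: "w x = g *s web_field t l x"
      and G: "\<And>u. W u = G u *s web_field t l x + g *s web_field_deriv t l u"
    using web_section[OF U w mem] by blast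
  have "((\<lambda>y. \<eta> y u v) has_derivative
      (\<lambda>h. f x * det_of (web_field_deriv t l h) u v + D h * det_of (web_field t l x) u v)) (at x)"
    by (rule has_derivative_transform_within_open[OF
          has_derivative_mult[OF f has_derivative_det_of[OF has_derivative_web_field]] U])
      (simp add: \<eta>)
  note d = frechet_derivative_at[OF this, symmetric]
  have hom: "web_field_deriv t l (g *s y) = g *s web_field_deriv t l y" for y
    by (simp add: web_field_deriv_def vec_eq_iff forall_3)
  have "lie_derivative w \<eta> x u v = D (w x) * det_of (web_field t l x) u v
    + f x * g * (det_of (web_field_deriv t l (web_field t l x)) u v
      + det_of (web_field t l x) (web_field_deriv t l u) v
      + det_of (web_field t l x) u (web_field_deriv t l v))"
    unfolding lie_derivative_def d frechet_derivative_at[OF w, symmetric] \<eta>[OF U(2)]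
    by (simp add: G g hom det_of_eq algebra_simps)
  then show ?thesis unfolding web_field_divergence_free by simp
qed

definition web_form :: "'k::real_normed_field \<Rightarrow> 4 \<Rightarrow> 'k two_form" where
  "web_form t l x u v = det_of (web_field t l x) u v"

lemma linear_scale_iff:
  "Vector_Spaces.linear (*s) (*) (f :: 'k::field ^ 'n \<Rightarrow> 'k) \<longleftrightarrow>
    (\<forall>x y. f (x + y) = f x + f y) \<and> (\<forall>c x. f (c *s x) = c * f x)"
  unfolding Vector_Spaces.linear_iff
  using vec.vector_space_axioms vector_space_over_itself.vector_space_axioms by blast

lemma alternating_bilinear_det_of: "alternating_bilinear (det_of (a :: 'k::field ^ 3))"
  unfolding alternating_bilinear_def linear_scale_iff
  by (auto simp: det_of_eq algebra_simps)

text \<open>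
  In dimension three every 2-form is the contraction of the volume form with a vector.
\<close>
lemma alternating_bilinear_eq_det_of:
  fixes b :: "'k::field ^ 3 \<Rightarrow> 'k ^ 3 \<Rightarrow> 'k"
  assumes "alternating_bilinear b"
  shows "b u v = det_of (vector [b (axis 2 1) (axis 3 1), b (axis 3 1) (axis 1 1), b (axis 1 1) (axis 2 1)]) u v"
proof -
  have add: "b (x + y) z = b x z + b y z" "b z (x + y) = b z x + b z y"
    and scale: "b (c *s x) z = c * b x z" "b z (c *s x) = c * b z x"
    and alt: "b x x = 0" for x y z c
    using assms unfolding alternating_bilinear_def linear_scale_iff by auto
  have swap: "b x y = - b y x" for x y
  proof -
    have "b (x + y) (x + y) = b x y + b y x" unfolding add by (simp add: alt)
    then show ?thesis unfolding alt by (simp add: eq_neg_iff_add_eq_0)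
  qed
  have decomp: "x = x $ 1 *s axis 1 1 + x $ 2 *s axis 2 1 + x $ 3 *s axis 3 1" for x :: "'k ^ 3"
    by (simp add: vec_eq_iff forall_3 axis_def)
  show ?thesis
    apply (subst decomp[of u], subst decomp[of v])
    apply (simp add: add scale alt det_of_eq swap[of "axis 2 1" "axis 1 1"] swap[of "axis 1 1" "axis 3 1"]
      swap[of "axis 3 1" "axis 2 1"] algebra_simps)
    done
qed

lemma det_of_left_kernel:
  assumes "\<And>v. det_of n (web_field t l x) v = 0"
  shows "\<exists>a. n = a *s web_field t l x"
proof -
  let ?V = "web_field t l x"
  have c: "n $ 2 * ?V $ 3 = n $ 3 * ?V $ 2" "n $ 3 * ?V $ 1 = n $ 1 * ?V $ 3" "n $ 1 * ?V $ 2 = n $ 2 * ?V $ 1"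
    using assms[of "axis 1 1"] assms[of "axis 2 1"] assms[of "axis 3 1"]
    by (simp_all add: det_of_eq axis_def algebra_simps)
  consider "l = 1" | "l = 2" | "l = 3" | "l = 4" using exhaust_4[of l] by blast
  then show ?thesis
  proof cases
    case 1 then show ?thesis using c
      by (intro exI[of _ "n $ 1"]) (simp add: web_field_nth vec_eq_iff forall_3)
  next
    case 2 then show ?thesis using c
      by (intro exI[of _ "n $ 2"]) (simp add: web_field_nth vec_eq_iff forall_3)
  next
    case 3 then show ?thesis using c
      by (intro exI[of _ "n $ 3"]) (simp add: web_field_nth vec_eq_iff forall_3)
  next
    case 4
    have "n $ 1 = - n $ 3 * (- 1 - x $ 2)" "n $ 2 = - n $ 3 * (- 1 - t * x $ 1)"
      using arg_cong[OF c(2), of uminus] arg_cong[OF c(1), of uminus] 4 by (simp_all add: web_field_nth)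
    then show ?thesis
      using 4 by (intro exI[of _ "- n $ 3"]) (simp add: web_field_nth vec_eq_iff forall_3)
  qed
qed

text \<open>
  Write each form as \<open>\<iota>\<^sub>n vol\<close>.  Being killed by \<open>V\<^sub>l\<close> makes \<open>n\<^sub>l\<close> a multiple of \<open>V\<^sub>l\<close>, and
  since the \<open>n\<^sub>l\<close> sum to zero all four multipliers coincide.  The multiplier is read off from
  the third form, as \<open>V\<^sub>3\<close> has third coordinate \<open>1\<close>.
\<close>
lemma relation_multiple_pointwise:
  assumes alt: "\<And>l. alternating_bilinear (b l)"
    and kill: "\<And>l v. b l (web_field t l x) v = 0"
    and sum: "\<And>u v. (\<Sum>l\<in>UNIV. b l u v) = 0"
  shows "b l u v = b 3 (axis 1 1) (axis 2 1) * web_form t l x u v"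
proof -
  define n where "n l = (vector [b l (axis 2 1) (axis 3 1), b l (axis 3 1) (axis 1 1), b l (axis 1 1) (axis 2 1)] :: 'a ^ 3)" for l
  have b: "b l u v = det_of (n l) u v" for l u v
    unfolding n_def by (rule alternating_bilinear_eq_det_of[OF alt])
  have "\<forall>l. \<exists>a. n l = a *s web_field t l x"
    using det_of_left_kernel[of "n _" t _ x] kill unfolding b by blast
  then obtain a where a: "\<And>l. n l = a l *s web_field t l x" by metis
  have "(\<Sum>l\<in>UNIV. n l) = 0"
    using sum[of "axis 2 1" "axis 3 1"] sum[of "axis 3 1" "axis 1 1"] sum[of "axis 1 1" "axis 2 1"]
    by (simp add: n_def vec_eq_iff forall_3)
  then have "a l = a 3" for l
    unfolding a by (rule web_field_relation)
  moreover have "n 3 $ 3 = a 3" unfolding a by (simp add: web_field_nth)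
  ultimately have *: "a l = b 3 (axis 1 1) (axis 2 1)"
    by (simp add: n_def)
  have "b l u v = a l * web_form t l x u v"
    unfolding b web_form_def a by (simp add: det_of_eq algebra_simps)
  then show ?thesis unfolding * .
qed


lemma web_form_abelian_relation:
  "abelian_relation (0 :: 'k::{real_normed_field,euclidean_space} ^ 3) (web t) (web_form t)"
  unfolding abelian_relation_def
proof (intro conjI allI always_eventually)
  fix l :: 4
  show "two_form_germ 0 (web_form t l)"
    unfolding two_form_germ_def
  proof (intro conjI allI always_eventually)
    show "alternating_bilinear (web_form t l x)" for x
      using alternating_bilinear_det_of unfolding web_form_def .
    fix u v :: "'k ^ 3"
    have V: "analytic_fun_at 0 (\<lambda>x. web_field t l x $ i)" for i
      using analytic_web_field unfolding analytic_map_at_def by blast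
    have "analytic_fun_at 0 (\<lambda>x. (u $ 2 * v $ 3 - u $ 3 * v $ 2) * web_field t l x $ 1
        + (u $ 3 * v $ 1 - u $ 1 * v $ 3) * web_field t l x $ 2
        + (u $ 1 * v $ 2 - u $ 2 * v $ 1) * web_field t l x $ 3)"
      by (intro analytic_fun_at_add analytic_fun_at_cmult V)
    then show "analytic_fun_at 0 (\<lambda>x. web_form t l x u v)"
      unfolding web_form_def det_of_eq by (simp only: mult.commute)
  qed
  show "basic_germ 0 (web t l) (web_form t l)"
    unfolding basic_germ_def
  proof (intro allI impI, elim conjE)
    fix w :: "'k ^ 3 \<Rightarrow> 'k ^ 3"
    assume "analytic_map_at 0 w" and mem: "\<forall>\<^sub>F x in nhds 0. w x \<in> web t l x"
    from this(1) have diff: "\<forall>\<^sub>F x in nhds 0. \<exists>W. (w has_derivative W) (at x) \<and> (\<forall>c u. W (c *s u) = c *s W u)"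
      by (rule analytic_map_at_has_linear_derivative)
    show "(\<forall>\<^sub>F x in nhds 0. \<forall>v. web_form t l x (w x) v = 0) \<and>
        (\<forall>\<^sub>F x in nhds 0. \<forall>u v. lie_derivative w (web_form t l) x u v = 0)"
    proof
      show "\<forall>\<^sub>F x in nhds 0. \<forall>v. web_form t l x (w x) v = 0"
        using mem by eventually_elim (auto simp: web_eq_range web_form_def det_of_eq algebra_simps)
      obtain U where U: "open U" "0 \<in> U" "\<And>y. y \<in> U \<Longrightarrow> w y \<in> web t l y"
        using mem unfolding eventually_nhds by auto
      show "\<forall>\<^sub>F x in nhds 0. \<forall>u v. lie_derivative w (web_form t l) x u v = 0"
        using diff eventually_nhds_in_open[OF U(1,2)]
      proof eventually_elim
        case (elim x)
        then obtain W where W: "(w has_derivative W) (at x)" by blast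
        show ?case
        proof (intro allI)
          fix u v
          show "lie_derivative w (web_form t l) x u v = 0"
            using lie_derivative_multiple[OF U(1) elim(2) W U(3) _ has_derivative_const[of 1],
                of "web_form t l" u v]
            by (simp add: web_form_def)
        qed
      qed
    qed
  qed
next
  fix x u v :: "'k ^ 3"
  have "(\<Sum>l\<in>UNIV. web_form t l x u v) = det_of (\<Sum>l\<in>UNIV. web_field t l x) u v"
    by (simp add: web_form_def sum_4 det_of_eq algebra_simps)
  then show "(\<Sum>l\<in>UNIV. web_form t l x u v) = 0"
    unfolding sum_web_field by (simp add: det_of_eq)
qed

lemma linear_vanishes_on_frame:
  fixes D :: "'k::real_normed_field ^ 3 \<Rightarrow> 'k"
  assumes add: "\<And>u v. D (u + v) = D u + D v" and scale: "\<And>c u. D (c *s u) = c * D u"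
    and zero: "\<And>l. D (web_field t l x) = 0"
  shows "D u = 0"
proof -
  have "u = (u $ 1 - u $ 3 * x $ 2) *s web_field t 1 x + (u $ 2 - u $ 3 * (t * x $ 1)) *s web_field t 2 x
      + u $ 3 *s web_field t 3 x"
    by (simp add: vec_eq_iff forall_3 web_field_nth)
  then have "D u = D ((u $ 1 - u $ 3 * x $ 2) *s web_field t 1 x + (u $ 2 - u $ 3 * (t * x $ 1)) *s web_field t 2 x
      + u $ 3 *s web_field t 3 x)"
    by (rule arg_cong)
  also have "\<dots> = 0" by (simp only: add scale zero) simp
  finally show ?thesis .
qed

text \<open>
  The common multiplier \<open>f\<close> of a relation has zero derivative along the four fields of the
  web, which span the tangent space, so it is locally constant.
\<close>
lemma abelian_relation_multiple:
  fixes t :: "'k::{real_normed_field,euclidean_space}"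
  assumes R: "abelian_relation 0 (web t) \<eta>"
  shows "\<exists>d. \<forall>\<^sub>F x in nhds 0. \<forall>l u v. \<eta> l x u v = d * web_form t l x u v"
proof -
  define f where "f x = \<eta> 3 x (axis 1 1) (axis 2 1)" for x
  have alt: "\<forall>\<^sub>F x in nhds 0. \<forall>l. alternating_bilinear (\<eta> l x)"
    by (rule eventually_all_finite) (use R in \<open>simp add: abelian_relation_def two_form_germ_def\<close>)
  have basic: "(\<forall>\<^sub>F x in nhds 0. \<forall>v. \<eta> l x (web_field t l x) v = 0) \<and>
      (\<forall>\<^sub>F x in nhds 0. \<forall>u v. lie_derivative (web_field t l) (\<eta> l) x u v = 0)" for l
  proof -
    have "basic_germ 0 (web t l) (\<eta> l)" using R by (simp add: abelian_relation_def)
    moreover have "\<forall>\<^sub>F x in nhds 0. web_field t l x \<in> web t l x"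
      by (simp add: web_def vec.span_base)
    ultimately show ?thesis unfolding basic_germ_def using analytic_web_field by blast
  qed
  have kill: "\<forall>\<^sub>F x in nhds 0. \<forall>l. \<forall>v. \<eta> l x (web_field t l x) v = 0"
    by (rule eventually_all_finite) (use basic in blast)
  have lie: "\<forall>\<^sub>F x in nhds 0. \<forall>l. \<forall>u v. lie_derivative (web_field t l) (\<eta> l) x u v = 0"
    by (rule eventually_all_finite) (use basic in blast)
  have sum: "\<forall>\<^sub>F x in nhds 0. \<forall>u v. (\<Sum>l\<in>UNIV. \<eta> l x u v) = 0"
    using R by (simp add: abelian_relation_def)
  have "analytic_fun_at 0 f"
    using R by (simp add: f_def[abs_def] abelian_relation_def two_form_germ_def)
  then have diff: "\<forall>\<^sub>F x in nhds 0. \<exists>D. (f has_derivative D) (at x) \<and> (\<forall>c u. D (c *s u) = c * D u)"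
    by (rule analytic_fun_at_has_linear_derivative)
  have "\<forall>\<^sub>F x in nhds 0. (\<forall>l u v. \<eta> l x u v = f x * web_form t l x u v)
      \<and> (\<forall>l u v. lie_derivative (web_field t l) (\<eta> l) x u v = 0)
      \<and> (\<exists>D. (f has_derivative D) (at x) \<and> (\<forall>c u. D (c *s u) = c * D u))"
    using alt kill sum lie diff
  proof eventually_elim
    case (elim x)
    have "\<eta> l x u v = f x * web_form t l x u v" for l u v
      unfolding f_def by (rule relation_multiple_pointwise[of "\<lambda>l. \<eta> l x"]) (use elim in auto)
    with elim show ?case by blast
  qed
  then obtain r where "r > 0" and r: "\<And>x. x \<in> ball 0 r \<Longrightarrow> (\<forall>l u v. \<eta> l x u v = f x * web_form t l x u v)
      \<and> (\<forall>l u v. lie_derivative (web_field t l) (\<eta> l) x u v = 0)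
      \<and> (\<exists>D. (f has_derivative D) (at x) \<and> (\<forall>c u. D (c *s u) = c * D u))"
    unfolding eventually_nhds_metric by (auto simp: dist_commute)
  have deriv0: "(f has_derivative (\<lambda>h. 0)) (at x)" if x: "x \<in> ball 0 r" for x
  proof -
    obtain D where D: "(f has_derivative D) (at x)" and scale: "\<And>c u. D (c *s u) = c * D u"
      using r[OF x] by blast
    have zero: "D (web_field t l x) = 0" for l
    proof -
      have "\<eta> l y u v = f y * det_of (web_field t l y) u v" if "y \<in> ball 0 r" for y u v
        using r[OF that] by (simp add: web_form_def)
      from lie_derivative_multiple[OF open_ball x has_derivative_web_field[of t l x] _ this D]
      have "lie_derivative (web_field t l) (\<eta> l) x u v = D (web_field t l x) * det_of (web_field t l x) u v" for u v
        by (simp add: web_def vec.span_base)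
      then have "D (web_field t l x) * det_of (web_field t l x) u v = 0" for u v
        using r[OF x] by metis
      then have *: "D (web_field t l x) = 0 \<or> (\<forall>u v. det_of (web_field t l x) u v = 0)"
        by auto
      have "det_of (web_field t l x) (axis 2 1) (axis 3 1) = web_field t l x $ 1"
        "det_of (web_field t l x) (axis 3 1) (axis 1 1) = web_field t l x $ 2"
        "det_of (web_field t l x) (axis 1 1) (axis 2 1) = web_field t l x $ 3"
        by (simp_all add: det_of_eq axis_def)
      with * show ?thesis using web_field_neq_0[of t l x]
        by (auto simp: vec_eq_iff forall_3)
    qed
    have "D u = 0" for u
      by (rule linear_vanishes_on_frame[OF linear_add[OF has_derivative_linear[OF D]] scale zero])
    then have "D = (\<lambda>h. 0)" by (rule ext)
    with D show ?thesis by simp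
  qed
  have const: "f x = f 0" if "x \<in> ball 0 r" for x
    by (rule has_derivative_zero_unique[OF convex_ball has_derivative_at_withinI[OF deriv0] that])
      (use \<open>r > 0\<close> in auto)
  show ?thesis
  proof (intro exI[of _ "f 0"] eventually_mono[OF eventually_nhds_in_open[of "ball 0 r" 0]])
    show "\<forall>l u v. \<eta> l x u v = f 0 * web_form t l x u v" if "x \<in> ball 0 r" for x
      using r[OF that] const[OF that] by simp
  qed (use \<open>r > 0\<close> in auto)
qed

lemma web_rank_web:
  fixes t :: "'k::{real_normed_field,euclidean_space}"
  shows "web_rank 0 (web t) = 1"
proof -
  have one: "independent_germs 0 1 (\<lambda>_. web_form t)"
    unfolding independent_germs_def
  proof (intro allI impI)
    fix c :: "nat \<Rightarrow> 'k" and i :: nat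
    assume "\<forall>\<^sub>F x in nhds 0. \<forall>l u v. (\<Sum>i<1. c i * web_form t l x u v) = 0" "i < 1"
    from eventually_nhds_x_imp_x[OF this(1)]
    have "(\<Sum>i<(1::nat). c i * web_form t 3 0 (axis 1 1) (axis 2 1)) = 0" by blast
    then have "c 0 * web_form t 3 0 (axis 1 1) (axis 2 1) = 0" by simp
    then show "c i = 0" using \<open>i < 1\<close>
      by (simp add: web_form_def det_of_eq web_field_nth axis_def)
  qed
  have le: "n \<le> 1" if rel: "\<forall>i<n. abelian_relation 0 (web t) (R i)" and ind: "independent_germs 0 n R" for n R
  proof (rule ccontr)
    assume "\<not> n \<le> 1"
    then have n: "0 < n" "1 < n" by auto
    obtain a where a: "\<forall>\<^sub>F x in nhds 0. \<forall>l u v. R 0 l x u v = a * web_form t l x u v"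
      using abelian_relation_multiple rel n by blast
    obtain b where b: "\<forall>\<^sub>F x in nhds 0. \<forall>l u v. R 1 l x u v = b * web_form t l x u v"
      using abelian_relation_multiple rel n by blast
    \<comment> \<open>a nontrivial combination killing the pair \<open>(a, b)\<close>\<close>
    define c where "c i = (if i = 0 then if a = 0 then 1 else b else if i = 1 then if a = 0 then 0 else - a else 0)" for i :: nat
    have "(\<Sum>i<n. c i * R i l x u v) = c 0 * R 0 l x u v + c 1 * R 1 l x u v" for l x u v
    proof -
      have "(\<Sum>i<n. c i * R i l x u v) = (\<Sum>i\<in>{0, 1}. c i * R i l x u v)"
        by (rule sum.mono_neutral_right) (use n in \<open>auto simp: c_def\<close>)
      then show ?thesis by simp
    qed
    moreover have "\<forall>\<^sub>F x in nhds 0. \<forall>l u v. c 0 * R 0 l x u v + c 1 * R 1 l x u v = 0"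
      using a b by eventually_elim (simp add: c_def)
    ultimately have "\<forall>\<^sub>F x in nhds 0. \<forall>l u v. (\<Sum>i<n. c i * R i l x u v) = 0"
      by simp
    with ind have "\<forall>i<n. c i = 0" unfolding independent_germs_def by blast
    with n have "c 0 = 0" "c 1 = 0" by auto
    then show False by (auto simp: c_def split: if_splits)
  qed
  have "Sup {enat n | n. \<exists>R. (\<forall>i<n. abelian_relation 0 (web t) (R i)) \<and> independent_germs 0 n R} = enat 1"
  proof (rule antisym)
    show "Sup {enat n | n. \<exists>R. (\<forall>i<n. abelian_relation 0 (web t) (R i)) \<and> independent_germs 0 n R} \<le> enat 1"
      by (rule Sup_least) (use le in auto)
    show "enat 1 \<le> Sup {enat n | n. \<exists>R. (\<forall>i<n. abelian_relation 0 (web t) (R i)) \<and> independent_germs 0 n R}"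
    proof (rule Sup_upper)
      have "\<exists>R. (\<forall>i<1. abelian_relation 0 (web t) (R i)) \<and> independent_germs 0 1 R"
        by (rule exI[of _ "\<lambda>_. web_form t"]) (use one web_form_abelian_relation in simp)
      then show "enat 1 \<in> {enat n | n. \<exists>R. (\<forall>i<n. abelian_relation 0 (web t) (R i)) \<and> independent_germs 0 n R}"
        by blast
    qed
  qed
  then show ?thesis by (simp add: web_rank_def one_enat_def)
qed

section \<open>The parameter is determined by the foliations\<close>

lemma constant_on_segment:
  fixes g :: "'a::real_normed_vector \<Rightarrow> 'b::real_normed_vector"
  assumes deriv: "\<And>z. z \<in> closed_segment a b \<Longrightarrow> (g has_derivative G z) (at z)"
    and zero: "\<And>z. z \<in> closed_segment a b \<Longrightarrow> G z (b - a) = 0"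
  shows "g b = g a"
proof -
  define \<gamma> where "\<gamma> s = a + s *\<^sub>R (b - a)" for s :: real
  have seg: "\<gamma> s \<in> closed_segment a b" if "s \<in> {0..1}" for s
    using that unfolding closed_segment_def \<gamma>_def by (auto simp: algebra_simps intro!: exI[of _ s])
  have "((\<lambda>s. g (\<gamma> s)) has_derivative (\<lambda>h. 0)) (at s within {0..1})" if "s \<in> {0..1}" for s
  proof -
    have "(\<gamma> has_derivative (\<lambda>h. h *\<^sub>R (b - a))) (at s within {0..1})"
      unfolding \<gamma>_def by (auto intro!: derivative_eq_intros)
    from has_derivative_compose[OF this deriv[OF seg[OF that]]]
    have "((\<lambda>s. g (\<gamma> s)) has_derivative (\<lambda>h. G (\<gamma> s) (h *\<^sub>R (b - a)))) (at s within {0..1})" .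
    moreover have "G (\<gamma> s) (h *\<^sub>R (b - a)) = 0" for h
      using linear_scale[OF has_derivative_linear[OF deriv[OF seg[OF that]]]] zero[OF seg[OF that]] by simp
    ultimately show ?thesis by simp
  qed
  from has_derivative_zero_unique[OF convex_real_interval(5) this, of 1 0]
  show ?thesis by (simp add: \<gamma>_def)
qed

text \<open>
  If \<open>g\<close> does not vary in the direction \<open>v\<close>, neither does its derivative in any other direction.
  This replaces the symmetry of second derivatives in the rigidity argument, so that
  only first derivatives of an isomorphism are needed.
\<close>
lemma invariant_under_translation:
  fixes g :: "'a::real_normed_vector \<Rightarrow> 'b::real_normed_vector"
  assumes S: "open S" "convex S"
    and deriv: "\<And>z. z \<in> S \<Longrightarrow> (g has_derivative G z) (at z)"
    and zero: "\<And>z. z \<in> S \<Longrightarrow> G z v = 0"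
    and x: "x \<in> S" "x + v \<in> S"
  shows "G (x + v) = G x"
proof -
  define T where "T = S \<inter> (\<lambda>z. z + v) -` S"
  have "open T" unfolding T_def
    by (intro open_Int S open_vimage continuous_intros)
  have "x \<in> T" using x by (simp add: T_def)
  have inv: "g (z + v) = g z" if "z \<in> T" for z
  proof -
    have "closed_segment z (z + v) \<subseteq> S"
      using that S(2) by (intro closed_segment_subset) (auto simp: T_def)
    then show ?thesis
      by (intro constant_on_segment[where G=G] deriv) (auto intro: zero)
  qed
  have "((\<lambda>z. z + v) has_derivative (\<lambda>h. h)) (at x)"
    by (auto intro!: derivative_eq_intros)
  from has_derivative_compose[OF this deriv[OF x(2)]]
  have "((\<lambda>z. g (z + v)) has_derivative G (x + v)) (at x)" .
  from has_derivative_transform_within_open[OF this \<open>open T\<close> \<open>x \<in> T\<close> inv]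
  have "(g has_derivative G (x + v)) (at x)" .
  from has_derivative_unique[OF this deriv[OF x(1)]] show ?thesis .
qed

text \<open>
  A linear map sending the four lines to the four lines multiplies each generator by a factor;
  applied to the relation between the generators, it forces these factors to be equal.
\<close>
lemma web_morphism_derivative:
  assumes add: "\<And>u v. D (u + v) = D u + D v" and scale: "\<And>c u. D (c *s u) = c *s D u"
    and web: "\<And>l. D ` web t l x = web t' l y"
  shows "\<exists>h. h \<noteq> 0 \<and> (\<forall>l. D (web_field t l x) = h *s web_field t' l y)"
proof -
  have "\<forall>l. \<exists>a. D (web_field t l x) = a *s web_field t' l y"
  proof
    fix l
    have "D (web_field t l x) \<in> web t' l y"
      unfolding web[symmetric] by (intro imageI) (simp add: web_def vec.span_base)
    then show "\<exists>a. D (web_field t l x) = a *s web_field t' l y" by (auto simp: web_eq_range)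
  qed
  then obtain a where a: "\<And>l. D (web_field t l x) = a l *s web_field t' l y" by metis
  have "D 0 = 0" using scale[of 0 0] by simp
  have "(\<Sum>l\<in>UNIV. a l *s web_field t' l y) = D (\<Sum>l\<in>UNIV. web_field t l x)"
    by (simp only: a[symmetric] sum_4 add)
  then have "(\<Sum>l\<in>UNIV. a l *s web_field t' l y) = 0"
    unfolding sum_web_field \<open>D 0 = 0\<close> .
  then have eq: "a l = a 1" for l by (rule web_field_relation)
  have "web_field t' 1 y \<in> D ` web t 1 x" unfolding web by (simp add: web_def vec.span_base)
  then obtain c where "web_field t' 1 y = D (c *s web_field t 1 x)" by (auto simp: web_eq_range)
  then have "a 1 \<noteq> 0" using web_field_neq_0[of t' 1 y] by (auto simp: scale a)
  then show ?thesis using a eq by metis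
qed

lemma norm_smult_axis: "norm (c *s axis i 1 :: 'k::real_normed_field ^ 'n) = norm c"
proof -
  have "norm (c *s axis i 1 :: 'k ^ 'n) = L2_set (\<lambda>j. if j = i then norm c else 0) UNIV"
    unfolding norm_vec_def by (rule L2_set_cong) (auto simp: axis_def)
  then show ?thesis by (simp add: L2_set_def if_distrib[of "\<lambda>x. x\<^sup>2"] cong: if_cong)
qed

lemma web_field_12: "web_field t 1 x = axis 1 1" "web_field t 2 x = axis 2 1"
  by (simp_all add: web_field_nth vec_eq_iff forall_3 axis_def)

text \<open>
  At \<open>x\<close> the matrix of the derivative of \<open>\<phi>\<close>, with respect to the standard basis, is \<open>h x\<close> times
  the one with rows \<open>(1, 0, \<phi>\<^sub>2 - x\<^sub>2)\<close>, \<open>(0, 1, t' \<phi>\<^sub>1 - t x\<^sub>1)\<close> and \<open>(0, 0, 1)\<close>.  So \<open>\<phi>\<^sub>1\<close>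
  and all its partial derivatives are independent of \<open>x\<^sub>2\<close>, and those of \<open>\<phi>\<^sub>2\<close> are
  independent of \<open>x\<^sub>1\<close>.  Hence \<open>h\<close> equals \<open>h 0\<close> on both axes \<open>x\<^sub>2 = x\<^sub>3 = 0\<close> and
  \<open>x\<^sub>1 = x\<^sub>3 = 0\<close>, where consequently \<open>\<phi>\<^sub>1 = h 0 * x\<^sub>1\<close> and \<open>\<phi>\<^sub>2 = h 0 * x\<^sub>2\<close>, respectively.
  Comparing \<open>\<partial>\<^sub>3 \<phi>\<^sub>1\<close> at the origin and on the second axis gives \<open>h 0 = 1\<close>, and then
  \<open>\<partial>\<^sub>3 \<phi>\<^sub>2\<close> on the first axis gives \<open>t' = t\<close>.
\<close>
lemma web_rigidity:
  fixes t t' :: "'k::{real_normed_field,euclidean_space}"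
  assumes ev: "\<forall>\<^sub>F x in nhds 0. \<exists>D. (\<phi> has_derivative D) (at x) \<and> (\<forall>c u. D (c *s u) = c *s D u)
      \<and> (\<forall>l. D ` web t l x = web t' l (\<phi> x))"
    and fix0: "\<phi> 0 = 0"
  shows "t = t'"
proof -
  obtain r where "r > 0" and r: "\<And>x. x \<in> ball 0 r \<Longrightarrow> \<exists>D. (\<phi> has_derivative D) (at x) \<and> (\<forall>c u. D (c *s u) = c *s D u)
      \<and> (\<forall>l. D ` web t l x = web t' l (\<phi> x))"
    using ev unfolding eventually_nhds_metric by (auto simp: dist_commute)
  define S where "S = ball (0 :: 'k ^ 3) r"
  have "\<exists>D h. (\<phi> has_derivative D) (at x) \<and> (\<forall>c u. D (c *s u) = c *s D u)
      \<and> h \<noteq> 0 \<and> (\<forall>l. D (web_field t l x) = h *s web_field t' l (\<phi> x))" if "x \<in> S" for x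
  proof -
    obtain D where D: "(\<phi> has_derivative D) (at x)" "\<And>c u. D (c *s u) = c *s D u"
        "\<And>l. D ` web t l x = web t' l (\<phi> x)"
      using r \<open>x \<in> S\<close> unfolding S_def by blast
    from web_morphism_derivative[OF linear_add[OF has_derivative_linear[OF D(1)]] D(2,3)] D(1,2)
    show ?thesis by blast
  qed
  then obtain D h where D: "\<And>x. x \<in> S \<Longrightarrow> (\<phi> has_derivative D x) (at x)"
      and scale: "\<And>x c u. x \<in> S \<Longrightarrow> D x (c *s u) = c *s D x u"
      and h0: "\<And>x. x \<in> S \<Longrightarrow> h x \<noteq> 0"
      and field: "\<And>x l. x \<in> S \<Longrightarrow> D x (web_field t l x) = h x *s web_field t' l (\<phi> x)"
    by metis
  define G where "G i x u = D x u $ i" for i :: 3 and x u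
  have G: "((\<lambda>y. \<phi> y $ i) has_derivative G i x) (at x)" if "x \<in> S" for i x
    unfolding G_def by (rule has_derivative_vec_nth[OF D[OF that]])
  have D12: "D x (axis 1 1) = h x *s axis 1 1" "D x (axis 2 1) = h x *s axis 2 1" if "x \<in> S" for x
    using field[OF that, of 1] field[OF that, of 2] by (simp_all add: web_field_12)
  have D3: "D x (axis 3 1) = h x *s (web_field t' 3 (\<phi> x) - x $ 2 *s axis 1 1 - (t * x $ 1) *s axis 2 1)"
    if "x \<in> S" for x
  proof -
    have "axis 3 1 = web_field t 3 x + (- (x $ 2)) *s axis 1 1 + (- (t * x $ 1)) *s axis 2 1"
      by (simp add: vec_eq_iff forall_3 web_field_nth axis_def)
    then have "D x (axis 3 1) = D x (web_field t 3 x + (- (x $ 2)) *s axis 1 1 + (- (t * x $ 1)) *s axis 2 1)"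
      by (rule arg_cong)
    also have "\<dots> = h x *s web_field t' 3 (\<phi> x) + (- (x $ 2)) *s (h x *s axis 1 1) + (- (t * x $ 1)) *s (h x *s axis 2 1)"
      by (simp only: linear_add[OF has_derivative_linear[OF D[OF that]]] scale[OF that] D12[OF that] field[OF that])
    finally show ?thesis by (simp add: vec_eq_iff algebra_simps)
  qed
  have G1: "G 1 x (axis 1 1) = h x" "G 1 x (axis 2 1) = 0" "G 1 x (axis 3 1) = h x * (\<phi> x $ 2 - x $ 2)"
    and G2: "G 2 x (axis 1 1) = 0" "G 2 x (axis 2 1) = h x" "G 2 x (axis 3 1) = h x * (t' * \<phi> x $ 1 - t * x $ 1)"
    if "x \<in> S" for x
    unfolding G_def using D12[OF that] D3[OF that]
    by (simp_all add: axis_def web_field_nth right_diff_distrib)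
  have G_scale: "G i x (c *s u) = c * G i x u" if "x \<in> S" for i x c u
    using scale[OF that] by (simp add: G_def)
  have S: "open S" "convex S" "0 \<in> S" using \<open>r > 0\<close> by (auto simp: S_def)
  have axis_S: "c *s axis i 1 \<in> S" if "norm c < r" for c i
    using that by (simp add: S_def norm_smult_axis)
  have inv1: "G 1 (c *s axis 2 1) = G 1 0" and inv2: "G 2 (c *s axis 1 1) = G 2 0" if "norm c < r" for c
    using invariant_under_translation[where G="G 1" and v="c *s axis 2 1", OF S(1,2) G _ S(3)]
      invariant_under_translation[where G="G 2" and v="c *s axis 1 1", OF S(1,2) G _ S(3)]
      axis_S[OF that] by (simp_all add: G_scale G1 G2)
  \<comment> \<open>\<open>h\<close> is both \<open>\<partial>\<^sub>1 \<phi>\<^sub>1\<close> and \<open>\<partial>\<^sub>2 \<phi>\<^sub>2\<close>; on each axis the one that is constant there is used\<close>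
  have h1: "h (c *s axis 1 1) = h 0" and h2: "h (c *s axis 2 1) = h 0" if "norm c < r" for c
    using G1(1) G2(2) inv1[OF that] inv2[OF that] axis_S[OF that] S(3) by metis+
  have chi: "\<phi> (c *s axis i 1) $ i = h 0 * c"
    if i: "\<And>c. norm c < r \<Longrightarrow> G i (c *s axis i 1) (axis i 1) = h 0" and c: "norm c < r" for i c
  proof -
    have seg: "\<exists>b. z = b *s axis i 1 \<and> norm b < r" if "z \<in> closed_segment 0 (c *s axis i 1)" for z :: "'k ^ 3"
    proof -
      from that obtain s where s: "0 \<le> s" "s \<le> 1" "z = s *\<^sub>R (c *s axis i 1)"
        by (auto simp: closed_segment_def)
      have "norm (s *\<^sub>R c) \<le> norm c"
        using s by (simp add: mult_left_le_one_le)
      with s c show ?thesis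
        by (intro exI[of _ "s *\<^sub>R c"]) (simp add: vec_eq_iff)
    qed
    have "\<phi> (c *s axis i 1) $ i - h 0 * (c *s axis i 1) $ i = \<phi> 0 $ i - h 0 * 0 $ i"
    proof (rule constant_on_segment[where G="\<lambda>z u. G i z u - h 0 * u $ i"])
      fix z assume "z \<in> closed_segment 0 (c *s axis i 1)"
      then obtain b where b: "z = b *s axis i 1" "norm b < r" using seg by blast
      then have z: "z \<in> S" using axis_S by simp
      show "((\<lambda>z. \<phi> z $ i - h 0 * z $ i) has_derivative (\<lambda>u. G i z u - h 0 * u $ i)) (at z)"
        by (intro has_derivative_diff G z has_derivative_mult_right has_derivative_vec_nth has_derivative_ident)
      show "G i z (c *s axis i 1 - 0) - h 0 * (c *s axis i 1 - 0) $ i = 0"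
        using i[OF b(2)] by (simp add: G_scale[OF z] b(1)[symmetric])
    qed
    then show ?thesis by (simp add: fix0)
  qed
  define a :: 'k where "a = of_real (r / 2)"
  have a: "norm a < r" "a \<noteq> 0" using \<open>r > 0\<close> by (simp_all add: a_def)
  have chi1: "\<phi> (a *s axis 1 1) $ 1 = h 0 * a"
    by (rule chi[OF _ a(1)]) (use G1(1) h1 axis_S in metis)
  have chi2: "\<phi> (a *s axis 2 1) $ 2 = h 0 * a"
    by (rule chi[OF _ a(1)]) (use G2(2) h2 axis_S in metis)
  have "h 0 * (h 0 * a - a) = 0"
    using G1(3)[OF axis_S[OF a(1)], of 2] G1(3)[OF S(3)]
    by (simp add: inv1[OF a(1)] h2[OF a(1)] chi2 fix0)
  then have "(h 0 - 1) * a = 0" using h0[OF S(3)] by (simp add: algebra_simps)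
  then have h: "h 0 = 1" using a(2) by simp
  have "t' * a - t * a = 0"
    using G2(3)[OF axis_S[OF a(1)], of 1] G2(3)[OF S(3)]
    by (simp add: inv2[OF a(1)] h1[OF a(1)] chi1 fix0 h)
  then show ?thesis using a(2) by simp
qed

section \<open>Counting isomorphism classes\<close>

lemma web_rank_one: "(0, web (t :: 'k::{real_normed_field,euclidean_space})) \<in> rank_one_web_germs"
  by (simp add: rank_one_web_germs_def web_germ_web web_rank_web)

lemma web_iso_refl:
  fixes t :: "'k::{real_normed_field,euclidean_space}"
  shows "((0, web t), (0, web t)) \<in> rank_one_web_iso"
proof -
  have id: "analytic_map_at 0 (\<lambda>x :: 'k ^ 3. x)"
    by (simp add: analytic_map_at_def analytic_fun_at_coordinate)
  have "frechet_derivative (\<lambda>y :: 'k ^ 3. y) (at x) = (\<lambda>h. h)" for x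
    using frechet_derivative_at[OF has_derivative_ident] by metis
  then have "web_germ_isomorphic (0, web t) (0, web t)"
    unfolding web_germ_isomorphic_def prod.case
    by (intro exI[of _ "\<lambda>x. x"]) (simp add: id bij_id[unfolded id_def])
  then show ?thesis by (simp add: rank_one_web_iso_def web_rank_one)
qed

text \<open>
  The part of an isomorphism that rigidity needs.  It asks only for differentiability, so that
  composing isomorphisms does not require the analyticity of composite maps.
\<close>
definition web_map_germ :: "(4 \<Rightarrow> 4) \<Rightarrow> 'k::real_normed_field \<Rightarrow> 'k \<Rightarrow> ('k ^ 3 \<Rightarrow> 'k ^ 3) \<Rightarrow> bool" where
  "web_map_germ \<sigma> s t \<phi> \<longleftrightarrow> (\<forall>\<^sub>F x in nhds 0. \<exists>D. (\<phi> has_derivative D) (at x)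
     \<and> (\<forall>c u. D (c *s u) = c *s D u) \<and> (\<forall>l. D ` web s l x = web t (\<sigma> l) (\<phi> x)))"

lemma web_iso_obtain:
  fixes s t :: "'k::{real_normed_field,euclidean_space}"
  assumes "((0, web s), (0, web t)) \<in> rank_one_web_iso"
  obtains \<phi> \<psi> \<sigma> where "bij \<sigma>" "\<phi> 0 = 0" "\<psi> 0 = 0" "analytic_map_at 0 \<psi>" "web_map_germ \<sigma> s t \<phi>"
    "\<forall>\<^sub>F x in nhds 0. \<psi> (\<phi> x) = x" "\<forall>\<^sub>F y in nhds 0. \<phi> (\<psi> y) = y"
proof -
  obtain \<phi> \<psi> \<sigma> where \<phi>: "analytic_map_at 0 \<phi>" "\<phi> 0 = 0" and \<psi>: "analytic_map_at 0 \<psi>" "\<psi> 0 = 0"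
    and inv: "\<forall>\<^sub>F x in nhds 0. \<psi> (\<phi> x) = x" "\<forall>\<^sub>F y in nhds 0. \<phi> (\<psi> y) = y" and "bij \<sigma>"
    and web: "\<forall>\<^sub>F x in nhds 0. \<forall>l. frechet_derivative \<phi> (at x) ` web s l x = web t (\<sigma> l) (\<phi> x)"
    using assms unfolding rank_one_web_iso_def web_germ_isomorphic_def by auto
  have "web_map_germ \<sigma> s t \<phi>"
    unfolding web_map_germ_def
    using web analytic_map_at_has_linear_derivative[OF \<phi>(1)]
  proof eventually_elim
    case (elim x)
    then obtain D where D: "(\<phi> has_derivative D) (at x)" "\<forall>c u. D (c *s u) = c *s D u" by blast
    from elim(1) show ?case
      unfolding frechet_derivative_at[OF D(1), symmetric] using D by blast
  qed
  with that \<open>bij \<sigma>\<close> \<phi> \<psi> inv show ?thesis by blast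
qed

lemma web_map_germ_inverse:
  fixes s t :: "'k::{real_normed_field,euclidean_space}"
  assumes \<phi>: "web_map_germ \<sigma> s t \<phi>" and \<psi>: "analytic_map_at 0 \<psi>" "\<psi> 0 = 0"
    and inv: "\<forall>\<^sub>F x in nhds 0. \<psi> (\<phi> x) = x" "\<forall>\<^sub>F y in nhds 0. \<phi> (\<psi> y) = y"
  shows "\<forall>\<^sub>F y in nhds 0. \<exists>E. (\<psi> has_derivative E) (at y) \<and> (\<forall>c u. E (c *s u) = c *s E u)
      \<and> (\<forall>l. E ` web t (\<sigma> l) y = web s l (\<psi> y))"
    and "filterlim \<psi> (nhds 0) (nhds 0)"
proof -
  have diff: "\<forall>\<^sub>F y in nhds 0. \<exists>E. (\<psi> has_derivative E) (at y) \<and> (\<forall>c u. E (c *s u) = c *s E u)"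
    by (rule analytic_map_at_has_linear_derivative[OF \<psi>(1)])
  from eventually_nhds_x_imp_x[OF this] have "isCont \<psi> 0"
    using has_derivative_continuous by blast
  then show lim: "filterlim \<psi> (nhds 0) (nhds 0)"
    using tendsto_at_iff_tendsto_nhds[of \<psi> 0] by (simp add: isCont_def \<psi>(2))
  obtain U where U: "open U" "0 \<in> U" "\<And>x. x \<in> U \<Longrightarrow> \<psi> (\<phi> x) = x"
    using inv(1) unfolding eventually_nhds by auto
  show "\<forall>\<^sub>F y in nhds 0. \<exists>E. (\<psi> has_derivative E) (at y) \<and> (\<forall>c u. E (c *s u) = c *s E u)
      \<and> (\<forall>l. E ` web t (\<sigma> l) y = web s l (\<psi> y))"
    using diff inv(2) eventually_compose_filterlim[OF \<phi>[unfolded web_map_germ_def] lim]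
      eventually_compose_filterlim[OF eventually_nhds_in_open[OF U(1,2)] lim]
  proof eventually_elim
    case (elim y)
    obtain E where E: "(\<psi> has_derivative E) (at y)" "\<forall>c u. E (c *s u) = c *s E u"
      using elim(1) by blast
    obtain D where D: "(\<phi> has_derivative D) (at (\<psi> y))"
        "\<And>l. D ` web s l (\<psi> y) = web t (\<sigma> l) (\<phi> (\<psi> y))"
      using elim(3) by blast
    have "((\<lambda>x. \<psi> (\<phi> x)) has_derivative (\<lambda>h. E (D h))) (at (\<psi> y))"
      by (rule has_derivative_compose[OF D(1)]) (simp add: elim(2) E(1))
    from has_derivative_transform_within_open[OF this U(1) elim(4) U(3)]
    have "((\<lambda>x. x) has_derivative (\<lambda>h. E (D h))) (at (\<psi> y))" .
    from has_derivative_unique[OF this has_derivative_ident] have "E (D h) = h" for h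
      by (rule fun_cong)
    then have "E ` D ` web s l (\<psi> y) = web s l (\<psi> y)" for l
      by (simp add: image_image)
    then have "E ` web t (\<sigma> l) y = web s l (\<psi> y)" for l
      unfolding D(2) elim(2) .
    with E show ?case by blast
  qed
qed

text \<open>
  Two isomorphisms out of the same web that permute the foliations in the same way differ by
  an isomorphism that preserves each foliation, to which rigidity applies.
\<close>
lemma web_iso_same_permutation:
  fixes s t t' :: "'k::{real_normed_field,euclidean_space}"
  assumes \<phi>: "web_map_germ \<sigma> s t \<phi>" and \<psi>: "analytic_map_at 0 \<psi>" "\<psi> 0 = 0"
    and inv: "\<forall>\<^sub>F x in nhds 0. \<psi> (\<phi> x) = x" "\<forall>\<^sub>F y in nhds 0. \<phi> (\<psi> y) = y"
    and \<phi>': "web_map_germ \<sigma> s t' \<phi>'" "\<phi>' 0 = 0" and "bij \<sigma>"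
  shows "t = t'"
proof (rule web_rigidity)
  note inverse = web_map_germ_inverse[OF \<phi> \<psi> inv]
  show "\<forall>\<^sub>F y in nhds 0. \<exists>D. ((\<lambda>y. \<phi>' (\<psi> y)) has_derivative D) (at y) \<and> (\<forall>c u. D (c *s u) = c *s D u)
      \<and> (\<forall>l. D ` web t l y = web t' l (\<phi>' (\<psi> y)))"
    using inverse(1) eventually_compose_filterlim[OF \<phi>'(1)[unfolded web_map_germ_def] inverse(2)]
  proof eventually_elim
    case (elim y)
    obtain E where E: "(\<psi> has_derivative E) (at y)" "\<And>c u. E (c *s u) = c *s E u"
        "\<And>l. E ` web t (\<sigma> l) y = web s l (\<psi> y)"
      using elim(1) by blast
    obtain D where D: "(\<phi>' has_derivative D) (at (\<psi> y))" "\<And>c u. D (c *s u) = c *s D u"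
        "\<And>l. D ` web s l (\<psi> y) = web t' (\<sigma> l) (\<phi>' (\<psi> y))"
      using elim(2) by blast
    have "(\<lambda>h. D (E h)) ` web t m y = web t' m (\<phi>' (\<psi> y))" for m
    proof -
      obtain l where l: "m = \<sigma> l" using bij_pointE[OF \<open>bij \<sigma>\<close>] by metis
      show ?thesis unfolding l D(3)[symmetric] E(3)[symmetric] image_image ..
    qed
    with has_derivative_compose[OF E(1) D(1)] show ?case
      by (intro exI[of _ "\<lambda>h. D (E h)"]) (simp add: D(2) E(2))
  qed
  show "\<phi>' (\<psi> 0) = 0" using \<psi>(2) \<phi>'(2) by simp
qed

text \<open>
  At most one parameter for each of the finitely many permutations of the foliations.
\<close>
lemma finite_isomorphic_webs:
  fixes s :: "'k::{real_normed_field,euclidean_space}"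
  shows "finite {t. ((0, web s), (0, web t)) \<in> rank_one_web_iso}"
proof -
  define P where "P \<sigma> t \<longleftrightarrow> bij \<sigma> \<and> (\<exists>\<phi> \<psi>. \<phi> 0 = 0 \<and> \<psi> 0 = 0 \<and> analytic_map_at 0 \<psi> \<and> web_map_germ \<sigma> s t \<phi>
      \<and> (\<forall>\<^sub>F x in nhds 0. \<psi> (\<phi> x) = x) \<and> (\<forall>\<^sub>F y in nhds 0. \<phi> (\<psi> y) = y))" for \<sigma> t
  have "t = t'" if "P \<sigma> t" "P \<sigma> t'" for \<sigma> t t'
  proof -
    from \<open>P \<sigma> t\<close> obtain \<phi> \<psi> where "web_map_germ \<sigma> s t \<phi>" "analytic_map_at 0 \<psi>" "\<psi> 0 = 0"
        "\<forall>\<^sub>F x in nhds 0. \<psi> (\<phi> x) = x" "\<forall>\<^sub>F y in nhds 0. \<phi> (\<psi> y) = y"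
      unfolding P_def by blast
    moreover from \<open>P \<sigma> t'\<close> obtain \<phi>' where "web_map_germ \<sigma> s t' \<phi>'" "\<phi>' 0 = 0" "bij \<sigma>"
      unfolding P_def by blast
    ultimately show ?thesis by (rule web_iso_same_permutation)
  qed
  then have "{t. P \<sigma> t} \<subseteq> {SOME t. P \<sigma> t}" for \<sigma>
    using someI[of "P \<sigma>"] by blast
  then have "finite {t. P \<sigma> t}" for \<sigma>
    by (rule finite_subset) simp
  then have "finite (\<Union>\<sigma>. {t. P \<sigma> t})" by simp
  moreover have "{t. ((0, web s), (0, web t)) \<in> rank_one_web_iso} \<subseteq> (\<Union>\<sigma>. {t. P \<sigma> t})"
  proof
    fix t assume "t \<in> {t. ((0, web s), (0, web t)) \<in> rank_one_web_iso}"
    then have "((0, web s), (0, web t)) \<in> rank_one_web_iso" by simp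
    then show "t \<in> (\<Union>\<sigma>. {t. P \<sigma> t})"
    proof (rule web_iso_obtain)
      fix \<phi> \<psi> \<sigma>
      assume "bij \<sigma>" "\<phi> 0 = 0" "\<psi> 0 = 0" "analytic_map_at 0 \<psi>" "web_map_germ \<sigma> s t \<phi>"
        "\<forall>\<^sub>F x in nhds 0. \<psi> (\<phi> x) = x" "\<forall>\<^sub>F y in nhds 0. \<phi> (\<psi> y) = y"
      then have "P \<sigma> t" unfolding P_def by blast
      then show ?thesis by blast
    qed
  qed
  ultimately show ?thesis by (rule finite_subset[rotated])
qed

lemma uncountable_rank_one_classes:
  assumes "uncountable (UNIV :: 'k::{real_normed_field,euclidean_space} set)"
  shows "uncountable ((rank_one_web_germs :: ((('k ^ 3) \<times> 'k web) set)) // rank_one_web_iso)"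
proof
  assume countable: "countable ((rank_one_web_germs :: ((('k ^ 3) \<times> 'k web) set)) // rank_one_web_iso)"
  define cls where "cls t = rank_one_web_iso `` {(0, web t)}" for t :: 'k
  have cls: "cls t \<in> rank_one_web_germs // rank_one_web_iso" for t
    unfolding cls_def by (rule quotientI[OF web_rank_one])
  have "countable {t. cls t = C}" for C
  proof (cases "\<exists>s. cls s = C")
    case True
    then obtain s where "cls s = C" by blast
    then have "{t. cls t = C} \<subseteq> {t. ((0, web s), (0, web t)) \<in> rank_one_web_iso}"
      using web_iso_refl unfolding cls_def by blast
    then show ?thesis
      by (rule countable_subset[OF _ countable_finite[OF finite_isomorphic_webs]])
  qed simp
  then have "countable (\<Union>C\<in>rank_one_web_germs // rank_one_web_iso. {t. cls t = C})"
    by (intro countable_UN countable)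
  moreover have "(\<Union>C\<in>rank_one_web_germs // rank_one_web_iso. {t. cls t = C}) = UNIV"
    using cls by blast
  ultimately show False using assms by simp
qed

theorem mainTheorem3:
  "uncountable ((rank_one_web_germs :: ((complex ^ 3) \<times> complex web) set) // rank_one_web_iso)
   \<and> uncountable ((rank_one_web_germs :: ((real ^ 3) \<times> real web) set) // rank_one_web_iso)"
  by (intro conjI uncountable_rank_one_classes uncountable_UNIV_complex uncountable_UNIV_real)

end
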